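(* Let $\alpha>0$ and $\theta>0$, and let $M$ and $R$ be independent random variables such that $M$ has pdf $\alpha x^{\alpha-1}$ on $(0,1)$ and $R$ is exponential with mean $\theta$. Let $X$ be a $\mathbb Z_+$-valued random variable with probability mass function $\{p_n\}$. The following assertions are equivalent. (i) $X$ is $[M,R]$-monotone. (ii) The pgf $\phi(s)$ of $X$ admits the representation $$\phi(s)=\theta^{-1}e^{\frac{1}{\theta(1-s)}}\int_s^1(1-w)^{-2}e^{-\frac{1}{\theta(1-w)}}Q(w)\,dw\qquad(0\le s<1),$$ where $Q(s)$ is the pgf of an $\alpha$-monotone distribution on $\mathbb Z_+$. (iii) Let $q_n=(2\theta n+1)p_n-\theta\bigl((n+1)p_{n+1}+(n-1)p_{n-1}\bigr)$, $n\ge0$ (with $p_{-1}=0$). Then for every $n\ge0$, $$q_n\ge0\quad\text{and}\quad(n+\alpha)q_n\ge(n+1)q_{n+1}.$$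
   Context: For $r\ge0$ and $0<m\le r+1$, $\psi_{m,r}(s)=1-m\frac{1-s}{1+r(1-s)}$, $s\in[0,1]$ (a probability generating function, pgf), and for a $\mathbb Z_+$-valued random variable $W$, $(m,r)\odot W=\sum_{i=1}^W Z_i$ (empty sum $=0$), where $\{Z_i\}$ is an iid sequence of $\mathbb Z_+$-valued random variables, independent of $W$, with pgf $\psi_{m,r}$. For $(M,R)$ random and independent of $W$, $(M,R)\odot W$ is the corresponding randomization: conditionally on $(M,R)=(m,r)$ it is distributed as $(m,r)\odot W$; thus if $G$ is the pgf of $W$, the pgf of $(M,R)\odot W$ is $E[G(\psi_{M,R}(s))]$. A $\mathbb Z_+$-valued random variable $X$ (or its distribution) is $[M,R]$-monotone if $X\overset{d}{=}(M,R)\odot W$ for some $\mathbb Z_+$-valued random variable $W$ independent of $(M,R)$. A distribution on $\mathbb Z_+$ is $\alpha$-monotone if it is the distribution of $(M,0)\odot W$ for some $\mathbb Z_+$-valued $W$ independent of $M$, where $M$ has pdf $\alpha x^{\alpha-1}$ on $(0,1)$; equivalently its pgf is $\alpha\int_0^1 G(1-m+ms)m^{\alpha-1}\,dm$ for some pgf $G$. *)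

theory Defs
  imports "HOL-Probability.Probability"
begin

definition pgf :: "nat measure \<Rightarrow> real \<Rightarrow> real" where
  "pgf \<mu> s = (\<integral>n. s ^ n \<partial>\<mu>)"

definition psi :: "real \<Rightarrow> real \<Rightarrow> real \<Rightarrow> real" where
  "psi m r s = 1 - m * (1 - s) / (1 + r * (1 - s))"

text \<open>
  The common law of the \<open>Z\<^sub>i\<close>: the unique distribution on the naturals with pgf \<open>psi m r\<close>
  (lemma \<open>ex1_psi_pmf\<close> below). The value outside the range \<open>0 \<le> r\<close>, \<open>0 < m \<le> r + 1\<close> is arbitrary;
  a constant is chosen there so that the kernel in \<open>rand_thin\<close> is measurable on the whole plane.
\<close>
definition psi_pmf :: "real \<Rightarrow> real \<Rightarrow> nat pmf" where
  "psi_pmf m r =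
     (if 0 \<le> r \<and> 0 < m \<and> m \<le> r + 1
      then (THE p. \<forall>s\<in>{0..1}. pgf (measure_pmf p) s = psi m r s)
      else return_pmf 0)"

text \<open>
  Law of \<open>(m,r) \<odot> W = Z\<^sub>1 + \<dots> + Z\<^sub>W\<close>, where \<open>W\<close> is represented by its law:
  draw \<open>n\<close> from \<open>W\<close>, then add up \<open>n\<close> independent draws from \<open>psi_pmf m r\<close>.
\<close>
definition thin :: "real \<Rightarrow> real \<Rightarrow> nat pmf \<Rightarrow> nat pmf" where
  "thin m r W = bind_pmf W (\<lambda>n. map_pmf sum_list (replicate_pmf n (psi_pmf m r)))"

text \<open>
  Law of \<open>(M,R) \<odot> W\<close> for \<open>(M,R)\<close> with joint law \<open>D\<close> and independent of \<open>W\<close>: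
  the mixture over \<open>D\<close> of the conditional laws \<open>thin m r W\<close>.
\<close>
definition rand_thin :: "(real \<times> real) measure \<Rightarrow> nat pmf \<Rightarrow> nat measure" where
  "rand_thin D W = D \<bind> (\<lambda>(m, r). measure_pmf (thin m r W))"

text \<open>\<open>\<mu>\<close> is \<open>[M,R]\<close>-monotone, where \<open>D\<close> is the joint law of \<open>(M,R)\<close>.\<close>
definition MR_monotone :: "(real \<times> real) measure \<Rightarrow> nat measure \<Rightarrow> bool" where
  "MR_monotone D \<mu> \<longleftrightarrow> (\<exists>W :: nat pmf. \<mu> = rand_thin D W)"

definition power_density :: "real \<Rightarrow> real \<Rightarrow> real" where
  "power_density \<alpha> x = (if 0 < x \<and> x < 1 then \<alpha> * x powr (\<alpha> - 1) else 0)"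

definition alpha_monotone :: "real \<Rightarrow> nat measure \<Rightarrow> bool" where
  "alpha_monotone \<alpha> \<mu> \<longleftrightarrow>
     MR_monotone
       (distr (density lborel (\<lambda>x. ennreal (power_density \<alpha> x))) (borel \<Otimes>\<^sub>M borel) (\<lambda>m. (m, 0))) \<mu>"

definition q_seq :: "real \<Rightarrow> (nat \<Rightarrow> real) \<Rightarrow> nat \<Rightarrow> real" where
  "q_seq \<theta> p n =
     (2 * \<theta> * real n + 1) * p n
     - \<theta> * ((real n + 1) * p (n + 1) + (real n - 1) * (if n = 0 then 0 else p (n - 1)))"


text \<open>Well-definedness of \<^const>\<open>psi_pmf\<close> and measurability of the kernel in \<^const>\<open>rand_thin\<close>.\<close>

lemma pgf_pmf_sums:
  assumes "0 \<le> s" "s \<le> 1"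
  shows "(\<lambda>n. pmf p n * s ^ n) sums pgf (measure_pmf p) s"
proof -
  have int: "integrable (measure_pmf p) (\<lambda>n. s ^ n)"
    by (rule measure_pmf.integrable_const_bound[where B = 1])
       (use assms in \<open>auto simp: power_le_one\<close>)
  have "integrable (count_space UNIV) (\<lambda>n. pmf p n * s ^ n)"
    using int unfolding measure_pmf_eq_density by (subst (asm) integrable_density) auto
  moreover have "pgf (measure_pmf p) s = (\<integral>n. pmf p n * s ^ n \<partial>count_space UNIV)"
    unfolding pgf_def measure_pmf_eq_density by (subst integral_density) auto
  ultimately show ?thesis
    using sums_integral_count_space_nat by metis
qed

lemma pgf_pmf_inject:
  assumes eq: "\<And>s. 0 \<le> s \<Longrightarrow> s \<le> 1 \<Longrightarrow> pgf (measure_pmf p) s = pgf (measure_pmf q) s"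
  shows "p = q"
proof (rule ccontr)
  assume "p \<noteq> q"
  define a where "a n = pmf p n - pmf q n" for n
  have "\<exists>n. a n \<noteq> 0"
    using \<open>p \<noteq> q\<close> by (auto simp: a_def pmf_eq_iff)
  define k where "k = (LEAST n. a n \<noteq> 0)"
  have k: "a k \<noteq> 0"
    unfolding k_def using \<open>\<exists>n. a n \<noteq> 0\<close> by (rule LeastI_ex)
  have below: "a i = 0" if "i < k" for i
    using that not_less_Least unfolding k_def by blast
  have sums0: "(\<lambda>n. a n * s ^ n) sums 0" if "0 \<le> s" "s \<le> 1" for s
    using sums_diff[OF pgf_pmf_sums[OF that, of p] pgf_pmf_sums[OF that, of q]] eq[OF that]
    by (simp add: a_def algebra_simps)
  have zero: "(\<lambda>i. a (i + k) * s ^ i) sums 0" if "0 < s" "s \<le> 1" for s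
  proof -
    have "(\<lambda>i. a (i + k) * s ^ (i + k)) sums 0"
      using sums_split_initial_segment[OF sums0[of s], of k] that below by simp
    from sums_mult[OF this, of "1 / s ^ k"] show ?thesis
      using that by (simp add: power_add)
  qed
  have summ: "summable (\<lambda>i. a (i + k) * 1 ^ i)"
    using zero[of 1] by (auto simp: sums_iff)
  have "isCont (\<lambda>x. \<Sum>i. a (i + k) * x ^ i) 0"
    by (rule isCont_powser[OF summ]) simp
  then have "((\<lambda>x. \<Sum>i. a (i + k) * x ^ i) \<longlongrightarrow> a k) (at_right 0)"
    by (auto simp: isCont_def intro: tendsto_within_subset)
  moreover have "\<forall>\<^sub>F x in at_right 0. (\<Sum>i. a (i + k) * x ^ i) = 0"
    by (rule eventually_mono[OF eventually_at_right_real[OF zero_less_one]])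
       (use zero in \<open>auto simp: sums_iff\<close>)
  ultimately have "((\<lambda>x::real. 0::real) \<longlongrightarrow> a k) (at_right 0)"
    using tendsto_cong by fast
  then show False
    using k by (simp add: tendsto_const_iff)
qed

lemma psi_pmf_eqI:
  assumes "0 \<le> r" "0 < m" "m \<le> r + 1" "\<And>s. s \<in> {0..1} \<Longrightarrow> pgf (measure_pmf p) s = psi m r s"
  shows "psi_pmf m r = p"
proof -
  have "(THE p. \<forall>s\<in>{0..1}. pgf (measure_pmf p) s = psi m r s) = p"
    using assms(4) by (intro the_equality) (auto intro!: pgf_pmf_inject)
  then show ?thesis
    using assms by (simp add: psi_pmf_def)
qed

definition psi_pmf_explicit :: "real \<Rightarrow> real \<Rightarrow> nat pmf" where
  "psi_pmf_explicit m r =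
     bind_pmf (bernoulli_pmf (m / (1 + r)))
       (\<lambda>b. if b then map_pmf Suc (geometric_pmf (1 / (1 + r))) else return_pmf 0)"

lemma pmf_psi_pmf_explicit:
  assumes "0 \<le> r" "0 < m" "m \<le> r + 1"
  shows "pmf (psi_pmf_explicit m r) n =
    (if n = 0 then 1 - m / (1 + r) else m / (1 + r) * ((r / (1 + r)) ^ (n - 1) * (1 / (1 + r))))"
proof -
  have a: "0 \<le> m / (1 + r)" "m / (1 + r) \<le> 1" and g: "0 < 1 / (1 + r)" "1 / (1 + r) \<le> 1"
    and r: "1 - 1 / (1 + r) = r / (1 + r)"
    using assms by (auto simp: field_simps)
  have n0: "pmf (map_pmf Suc (geometric_pmf (1 / (1 + r)))) 0 = 0"
    by (intro pmf_map_outside) auto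
  have nS: "pmf (map_pmf Suc (geometric_pmf (1 / (1 + r)))) (Suc k) = (r / (1 + r)) ^ k * (1 / (1 + r))"
    for k
    using g by (subst pmf_map_inj') (auto simp: pmf_geometric r)
  show ?thesis
    using a n0 nS by (cases n) (auto simp: psi_pmf_explicit_def pmf_bind)
qed

lemma pgf_psi_pmf_explicit:
  assumes mr: "0 \<le> r" "0 < m" "m \<le> r + 1" and s: "0 \<le> s" "s \<le> 1"
  shows "pgf (measure_pmf (psi_pmf_explicit m r)) s = psi m r s"
proof -
  let ?p = "\<lambda>n. pmf (psi_pmf_explicit m r) n * s ^ n"
  define x where "x = r / (1 + r) * s"
  have "r / (1 + r) < 1" "0 \<le> r / (1 + r)"
    using mr by auto
  then have x: "0 \<le> x" "x < 1"
    using s mult_left_le[of s "r / (1 + r)"] by (auto simp: x_def simp del: times_divide_eq_left)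
  have pos: "0 < 1 + r" "0 < 1 + r * (1 - s)"
    using mr s by (auto simp: add_pos_nonneg)
  have "(\<lambda>n. m / (1 + r) * (1 / (1 + r)) * s * x ^ n) sums (m / (1 + r) * (1 / (1 + r)) * s * (1 / (1 - x)))"
    using x by (intro sums_mult geometric_sums) auto
  also have "(\<lambda>n. m / (1 + r) * (1 / (1 + r)) * s * x ^ n) = (\<lambda>n. ?p (Suc n))"
    using mr by (simp add: fun_eq_iff pmf_psi_pmf_explicit x_def power_divide power_mult_distrib mult_ac)
  finally have "?p sums (m / (1 + r) * (1 / (1 + r)) * s * (1 / (1 - x)) + ?p 0)"
    by (subst (asm) sums_Suc_iff)
  then have "pgf (measure_pmf (psi_pmf_explicit m r)) s =
      m / (1 + r) * (1 / (1 + r)) * s * (1 / (1 - x)) + (1 - m / (1 + r))"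
    using sums_unique2[OF pgf_pmf_sums[OF s, of "psi_pmf_explicit m r"]] pmf_psi_pmf_explicit[OF mr, of 0]
    by simp
  also have "1 - x = (1 + r * (1 - s)) / (1 + r)"
    using pos by (simp add: x_def field_simps)
  also have "m / (1 + r) * (1 / (1 + r)) * s * (1 / ((1 + r * (1 - s)) / (1 + r))) + (1 - m / (1 + r))
      = psi m r s"
  proof -
    define d where "d = 1 + r * (1 - s)"
    have d: "d > 0" "(1 + r) * (1 - s) = d - s"
      using pos by (auto simp: d_def algebra_simps)
    have "m / (1 + r) * (1 / (1 + r)) * s * (1 / (d / (1 + r))) + (1 - m / (1 + r))
        = 1 - m * (d - s) / ((1 + r) * d)"
    proof -
      have "m / e * (1 / e) * s * (1 / (d / e)) + (1 - m / e) = 1 - m * (d - s) / (e * d)"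
        if "e > 0" for e
        using d(1) that by (simp add: field_simps)
      from this[OF pos(1)] show ?thesis .
    qed
    also have "\<dots> = psi m r s"
      unfolding d(2)[symmetric] using pos by (simp add: psi_def d_def)
    finally show ?thesis
      by (simp add: d_def)
  qed
  finally show ?thesis .
qed

lemma ex1_psi_pmf:
  assumes "0 \<le> r" "0 < m" "m \<le> r + 1"
  shows "\<exists>!p. \<forall>s\<in>{0..1}. pgf (measure_pmf p) s = psi m r s"
proof (rule ex1I)
  show "\<forall>s\<in>{0..1}. pgf (measure_pmf (psi_pmf_explicit m r)) s = psi m r s"
    using pgf_psi_pmf_explicit[OF assms] by auto
  show "p = psi_pmf_explicit m r" if "\<forall>s\<in>{0..1}. pgf (measure_pmf p) s = psi m r s" for p
    using that pgf_psi_pmf_explicit[OF assms] by (intro pgf_pmf_inject) auto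
qed

lemma psi_pmf_eq_explicit:
  assumes "0 \<le> r" "0 < m" "m \<le> r + 1"
  shows "psi_pmf m r = psi_pmf_explicit m r"
  using assms by (intro psi_pmf_eqI) (auto intro: pgf_psi_pmf_explicit)

lemma measurable_pmf_psi_pmf:
  "(\<lambda>x. pmf (psi_pmf (fst x) (snd x)) n) \<in> borel_measurable (borel \<Otimes>\<^sub>M borel)"
proof -
  have "(\<lambda>x. pmf (psi_pmf (fst x) (snd x)) n) =
    (\<lambda>x. if 0 \<le> snd x \<and> 0 < fst x \<and> fst x \<le> snd x + 1 then
       (if n = 0 then 1 - fst x / (1 + snd x)
        else fst x / (1 + snd x) * ((snd x / (1 + snd x)) ^ (n - 1) * (1 / (1 + snd x))))
       else indicator {0} n)"
    by (auto simp: fun_eq_iff psi_pmf_eq_explicit pmf_psi_pmf_explicit pmf_return)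
       (auto simp: psi_pmf_def indicator_def)
  then show ?thesis
    by simp
qed

lemma measurable_measure_pmf_nat:
  fixes f :: "'a \<Rightarrow> nat pmf"
  assumes "\<And>n. (\<lambda>x. pmf (f x) n) \<in> borel_measurable M"
  shows "(\<lambda>x. measure_pmf (f x)) \<in> measurable M (subprob_algebra (count_space UNIV))"
proof (rule measurable_subprob_algebra)
  fix A :: "nat set"
  have "emeasure (measure_pmf (f x)) A = (\<Sum>n. ennreal (pmf (f x) n) * indicator A n)" for x
    by (simp add: nn_integral_count_space_nat[symmetric] nn_integral_measure_pmf[symmetric])
  then show "(\<lambda>x. emeasure (measure_pmf (f x)) A) \<in> borel_measurable M"
    using assms by simp
qed (auto simp: measure_pmf.subprob_space_axioms)

lemma measurable_thin:
  "(\<lambda>(m, r). measure_pmf (thin m r W))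
     \<in> measurable (borel \<Otimes>\<^sub>M borel) (subprob_algebra (count_space UNIV))"
proof -
  have rep: "(\<lambda>x. pmf (map_pmf sum_list (replicate_pmf n (psi_pmf (fst x) (snd x)))) k)
    \<in> borel_measurable (borel \<Otimes>\<^sub>M borel)" for n k
  proof (induction n arbitrary: k)
    case 0
    then show ?case
      by (simp add: map_return_pmf)
  next
    case (Suc n)
    have *: "map_pmf sum_list (replicate_pmf (Suc n) p) =
      bind_pmf p (\<lambda>i. map_pmf ((+) i) (map_pmf sum_list (replicate_pmf n p)))" for p :: "nat pmf"
      by (simp add: map_bind_pmf map_pmf_def bind_assoc_pmf bind_return_pmf)
    have **: "pmf (map_pmf ((+) i) P) k = (if i \<le> k then pmf P (k - i) else 0)"
      for i k :: nat and P
    proof (cases "i \<le> k")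
      case True
      then have "pmf (map_pmf ((+) i) P) (i + (k - i)) = pmf P (k - i)"
        by (intro pmf_map_inj') auto
      with True show ?thesis by simp
    qed (auto intro!: pmf_map_outside)
    have "pmf (map_pmf sum_list (replicate_pmf (Suc n) p)) k =
      (\<Sum>i\<le>k. pmf p i * pmf (map_pmf sum_list (replicate_pmf n p)) (k - i))" for p :: "nat pmf"
      unfolding * pmf_bind
      by (subst integral_measure_pmf[of "{..k}"]) (auto simp: ** set_pmf_eq split: if_splits)
    then show ?case
      using Suc measurable_pmf_psi_pmf by (simp del: replicate_pmf.simps)
  qed
  have "ennreal (pmf (thin m r W) k) =
     (\<Sum>n. ennreal (pmf W n) * ennreal (pmf (map_pmf sum_list (replicate_pmf n (psi_pmf m r))) k))" for m r k
    by (simp add: thin_def ennreal_pmf_bind nn_integral_measure_pmf nn_integral_count_space_nat)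
  then have "pmf (thin m r W) k =
     enn2real (\<Sum>n. ennreal (pmf W n) * ennreal (pmf (map_pmf sum_list (replicate_pmf n (psi_pmf m r))) k))" for m r k
    by (metis enn2real_ennreal pmf_nonneg)
  then have "(\<lambda>x. pmf (thin (fst x) (snd x) W) k) \<in> borel_measurable (borel \<Otimes>\<^sub>M borel)" for k
    using rep by simp
  from measurable_measure_pmf_nat[of "\<lambda>x. thin (fst x) (snd x) W", OF this]
  show ?thesis
    by (simp add: case_prod_beta)
qed

end

theory Submission
  imports Defs
begin

text \<open>
  The thinning kernel factors: \<open>psi m r s = psi m 0 (psi 1 r s)\<close>. Let \<open>G\<close> be the generating function of
  \<open>W\<close>. Mixing over \<open>M\<close> first gives the generating function \<open>Q\<close> of an \<open>\<alpha>\<close>-monotone law, and mixing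
  over the independent \<open>R\<close> then gives the generating function \<open>\<phi>\<close> of \<open>(M, R) \<odot> W\<close>. After a change of
  variables both steps have the same shape: \<open>F s * f s\<close> is the integral of \<open>- F' w * h w\<close> over \<open>(s, 1)\<close>,
  with \<open>F s = (1 - s) powr \<alpha>\<close>, \<open>f = Q\<close>, \<open>h = G\<close> in the first step (lemma \<open>pgf_power_thinning\<close>) and
  \<open>F s = exp (- 1 / (\<theta> * (1 - s)))\<close>, \<open>f = \<phi>\<close>, \<open>h = Q\<close> in the second
  (lemma \<open>pgf_exponential_mixture\<close>). The second formula is the integral representation of \<open>\<phi>\<close>, so the
  equivalence of monotonicity with that representation only adds that generating functions determine laws.

  For the pointwise criterion, \<open>average_iff_ode\<close> turns each integral equation into a differential
  equation: \<open>G = Q - (1 - s) Q' / \<alpha>\<close> and \<open>Q = \<phi> - \<theta> (1 - s)\<^sup>2 \<phi>'\<close>. Comparing coefficients, the second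
  says that \<open>Q\<close> has coefficients \<open>q\<^sub>n\<close>, and the first that \<open>G\<close> has coefficients
  \<open>g\<^sub>n = ((n + \<alpha>) q\<^sub>n - (n + 1) q\<^sub>n\<^sub>+\<^sub>1) / \<alpha>\<close>. For a monotone law both sequences are therefore nonnegative.
  Conversely, nonnegative sequences \<open>q\<close> and \<open>g\<close> defined by these formulas automatically have total mass
  \<open>1\<close> (lemmas \<open>q_seq_sums_1\<close> and \<open>power_coeffs_sums_1\<close>), so they are laws, the differential equations
  hold, and the law with masses \<open>g\<^sub>n\<close> serves as \<open>W\<close>.
\<close>

section \<open>Generating functions as power series\<close>

text \<open>
  Only the values on \<open>(0, 1)\<close> are compared, so this is uniqueness of one-sided power series. If the
  coefficients differed, dividing the difference by \<open>s ^ k\<close> for the first index \<open>k\<close> where they do would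
  leave a series vanishing on \<open>(0, 1)\<close> whose limit at \<open>0\<close> is not zero.
\<close>

lemma power_series_unique:
  fixes a b :: "nat \<Rightarrow> real"
  assumes "\<And>s. 0 < s \<Longrightarrow> s < 1 \<Longrightarrow> (\<lambda>n. a n * s ^ n) sums f s"
    and "\<And>s. 0 < s \<Longrightarrow> s < 1 \<Longrightarrow> (\<lambda>n. b n * s ^ n) sums f s"
  shows "a = b"
proof (rule ccontr)
  assume "a \<noteq> b"
  define c where "c n = a n - b n" for n
  have "\<exists>n. c n \<noteq> 0"
    using \<open>a \<noteq> b\<close> by (auto simp: c_def fun_eq_iff)
  define k where "k = (LEAST n. c n \<noteq> 0)"
  have k: "c k \<noteq> 0"
    unfolding k_def using \<open>\<exists>n. c n \<noteq> 0\<close> by (rule LeastI_ex)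
  have below: "c i = 0" if "i < k" for i
    using that not_less_Least unfolding k_def by blast
  have zero: "(\<lambda>i. c (i + k) * s ^ i) sums 0" if "0 < s" "s < 1" for s
  proof -
    have "(\<lambda>n. c n * s ^ n) sums 0"
      using sums_diff[OF assms(1)[OF that] assms(2)[OF that]] by (simp add: c_def algebra_simps)
    then have "(\<lambda>i. c (i + k) * s ^ (i + k)) sums 0"
      using sums_split_initial_segment[of "\<lambda>n. c n * s ^ n" 0 k] below by simp
    from sums_mult[OF this, of "1 / s ^ k"] show ?thesis
      using that by (simp add: power_add)
  qed
  have "isCont (\<lambda>x. \<Sum>i. c (i + k) * x ^ i) 0"
    using zero[of "1/2"] by (intro isCont_powser[of _ "1/2"]) (auto simp: sums_iff)
  then have "((\<lambda>x. \<Sum>i. c (i + k) * x ^ i) \<longlongrightarrow> c k) (at_right 0)"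
    by (auto simp: isCont_def intro: tendsto_within_subset)
  moreover have "\<forall>\<^sub>F x in at_right 0. (\<Sum>i. c (i + k) * x ^ i) = 0"
    by (rule eventually_mono[OF eventually_at_right_real[OF zero_less_one]])
       (use zero in \<open>auto simp: sums_iff\<close>)
  ultimately have "((\<lambda>x::real. 0::real) \<longlongrightarrow> c k) (at_right 0)"
    using tendsto_cong by fast
  then show False
    using k by (simp add: tendsto_const_iff)
qed

lemma power_series_eq_iff:
  fixes a b :: "nat \<Rightarrow> real"
  assumes "\<And>s. 0 < s \<Longrightarrow> s < 1 \<Longrightarrow> (\<lambda>n. a n * s ^ n) sums f s"
    and "\<And>s. 0 < s \<Longrightarrow> s < 1 \<Longrightarrow> (\<lambda>n. b n * s ^ n) sums g s"
  shows "(\<forall>s. 0 < s \<and> s < 1 \<longrightarrow> f s = g s) \<longleftrightarrow> (\<forall>n. a n = b n)"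
proof
  assume "\<forall>s. 0 < s \<and> s < 1 \<longrightarrow> f s = g s"
  then have "a = b"
    using assms by (intro power_series_unique[of a f b]) auto
  then show "\<forall>n. a n = b n" by simp
next
  assume "\<forall>n. a n = b n"
  then have "a = b" by auto
  then show "\<forall>s. 0 < s \<and> s < 1 \<longrightarrow> f s = g s"
    using assms sums_unique2 by blast
qed

lemma pmf_eq_if_pgf_eq:
  assumes "\<And>s. 0 < s \<Longrightarrow> s < 1 \<Longrightarrow> pgf (measure_pmf p) s = pgf (measure_pmf q) s"
  shows "p = q"
proof -
  have "pmf p = pmf q"
  proof (rule power_series_unique)
    fix s :: real assume s: "0 < s" "s < 1"
    then show "(\<lambda>n. pmf p n * s ^ n) sums pgf (measure_pmf p) s"
      by (intro pgf_pmf_sums) auto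
    show "(\<lambda>n. pmf q n * s ^ n) sums pgf (measure_pmf p) s"
      unfolding assms[OF s] using s by (intro pgf_pmf_sums) auto
  qed
  then show ?thesis by (simp add: pmf_eq_iff)
qed

text \<open>
  Multiplication by \<open>1 - s\<close> is the backward difference of the coefficients. Applied to derivatives of
  generating functions it produces the differences out of which \<^const>\<open>q_seq\<close> is built.
\<close>

lemma sums_mult_one_minus:
  fixes c :: "nat \<Rightarrow> real"
  assumes "(\<lambda>n. c n * s ^ n) sums S"
  shows "(\<lambda>n. (c n - (if n = 0 then 0 else c (n - 1))) * s ^ n) sums ((1 - s) * S)"
proof -
  have "(\<lambda>n. (if n = 0 then 0 else c (n - 1)) * s ^ n) sums (s * S)"
    using sums_mult[OF assms, of s]
    by (subst sums_Suc_iff[symmetric, where f = "\<lambda>n. (if n = 0 then 0 else c (n - 1)) * s ^ n", simplified])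
       (simp add: mult_ac)
  from sums_diff[OF assms this] show ?thesis
    by (simp add: algebra_simps)
qed

definition pgf_deriv :: "nat pmf \<Rightarrow> real \<Rightarrow> real" where
  "pgf_deriv p s = (\<Sum>n. diffs (pmf p) n * s ^ n)"

lemma summable_pmf: "summable (pmf p)" for p :: "nat pmf"
  using pgf_pmf_sums[of 1 p] by (simp add: sums_iff)

lemma pgf_deriv_sums:
  assumes "0 < s" "s < 1"
  shows "(\<lambda>n. diffs (pmf p) n * s ^ n) sums pgf_deriv p s"
proof -
  have "summable (\<lambda>n. diffs (pmf p) n * s ^ n)"
    using assms summable_pmf[of p]
    by (intro termdiff_converges[of s 1])
      (auto intro: powser_inside[of "pmf p" 1] )
  then show ?thesis
    by (simp add: pgf_deriv_def summable_sums)
qed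

lemma pgf_has_derivative:
  assumes "0 < s" "s < 1"
  shows "(pgf (measure_pmf p) has_real_derivative pgf_deriv p s) (at s)"
proof (rule has_field_derivative_transform_within_open)
  show "((\<lambda>s. \<Sum>n. pmf p n * s ^ n) has_real_derivative pgf_deriv p s) (at s)"
    unfolding pgf_deriv_def using assms summable_pmf[of p] by (intro termdiffs_strong[of _ 1]) auto
  show "(\<Sum>n. pmf p n * x ^ n) = pgf (measure_pmf p) x" if "x \<in> {0<..<1}" for x
    using pgf_pmf_sums[of x p] that by (simp add: sums_iff)
qed (use assms in auto)

lemma pgf_bounds:
  assumes "0 \<le> s" "s \<le> 1"
  shows "0 \<le> pgf (measure_pmf p) s" "pgf (measure_pmf p) s \<le> 1"
proof -
  show "0 \<le> pgf (measure_pmf p) s"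
    unfolding pgf_def using assms by (intro Bochner_Integration.integral_nonneg) auto
  have "pgf (measure_pmf p) s \<le> (\<integral>n. 1 \<partial>measure_pmf p)"
    unfolding pgf_def using assms
    by (intro integral_mono measure_pmf.integrable_const_bound[where B = 1]) (auto simp: power_le_one)
  then show "pgf (measure_pmf p) s \<le> 1" by simp
qed

lemma ennreal_pgf:
  assumes "0 \<le> s" "s \<le> 1"
  shows "ennreal (pgf (measure_pmf p) s) = (\<integral>\<^sup>+n. ennreal (s ^ n) \<partial>measure_pmf p)"
  unfolding pgf_def using assms
  by (intro nn_integral_eq_integral[symmetric] measure_pmf.integrable_const_bound[where B = 1])
     (auto simp: power_le_one)

lemma pgf_isCont:
  "0 < s \<Longrightarrow> s < 1 \<Longrightarrow> isCont (pgf (measure_pmf p)) s"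
  using pgf_has_derivative by (blast intro: DERIV_isCont)

lemma pgf_continuous_bounded:
  "continuous_on {0<..<1} (pgf (measure_pmf p))"
  "0 < w \<Longrightarrow> w < 1 \<Longrightarrow> \<bar>pgf (measure_pmf p) w\<bar> \<le> 1"
  using pgf_bounds[of w p] by (auto intro!: continuous_at_imp_continuous_on pgf_isCont)

section \<open>Averages weighted by a survival function\<close>

text \<open>
  Here \<open>k = - F'\<close>. For \<open>s < 1\<close> the function \<open>w \<mapsto> k w / F s\<close> is the density on \<open>(s, 1)\<close> of a random
  variable \<open>V\<close> with \<open>P(V > w) = F w / F s\<close>. Both mixtures, over the power law and over the exponential
  law, replace a generating function \<open>h\<close> by \<open>s \<mapsto> E[h V]\<close> for such a \<open>V\<close>; only \<open>F\<close> differs.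
\<close>

locale survival_function =
  fixes F k :: "real \<Rightarrow> real"
  assumes deriv: "s < 1 \<Longrightarrow> (F has_real_derivative - k s) (at s)"
    and pos: "s < 1 \<Longrightarrow> 0 < F s"
    and nonneg: "s < 1 \<Longrightarrow> 0 \<le> k s"
    and cont: "continuous_on {..<1} k"
    and lim: "(F \<longlongrightarrow> 0) (at_left 1)"
begin

lemma isCont_k: "s < 1 \<Longrightarrow> isCont k s"
  using cont by (simp add: continuous_on_eq_continuous_at)

lemma set_integrable_k:
  assumes "s < 1"
  shows "set_integrable lborel {s<..<1} k"
proof -
  have "set_integrable lborel (einterval s 1) k"
  proof (rule interval_integral_FTC_nonneg)
    show "((\<lambda>s. - F s) has_real_derivative k x) (at x)" if "ereal x < 1" for x
      using DERIV_minus[OF deriv[of x]] that by auto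
    show "(((\<lambda>s. - F s) \<circ> real_of_ereal) \<longlongrightarrow> - F s) (at_right (ereal s))"
      using deriv[OF assms] unfolding ereal_tendsto_simps1
      by (intro tendsto_minus) (auto dest!: DERIV_isCont simp: isCont_def intro: tendsto_within_subset)
    show "(((\<lambda>s. - F s) \<circ> real_of_ereal) \<longlongrightarrow> 0) (at_left 1)"
      using tendsto_minus[OF lim] by (simp add: ereal_tendsto_simps1 one_ereal_def)
  qed (use assms isCont_k nonneg in \<open>auto simp: one_ereal_def\<close>)
  then show ?thesis
    by (simp add: one_ereal_def)
qed

lemma set_integrable_k_mult:
  assumes s: "0 \<le> s" "s < 1" and h: "continuous_on {0<..<1} h" "\<And>w. 0 < w \<Longrightarrow> w < 1 \<Longrightarrow> \<bar>h w\<bar> \<le> 1"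
  shows "set_integrable lborel {s<..<1} (\<lambda>w. k w * h w)"
proof -
  have "set_borel_measurable borel {s<..<1} (\<lambda>w. k w * h w)"
    unfolding set_borel_measurable_def using s by (intro borel_measurable_continuous_on_indicator continuous_intros
      continuous_on_subset[OF cont] continuous_on_subset[OF h(1)]) auto
  then show ?thesis
    using s h(2) nonneg
    by (intro set_integrable_bound[OF set_integrable_k[OF s(2)]])
       (auto simp: abs_mult set_borel_measurable_def intro!: mult_left_le AE_I2)
qed

text \<open>
  Both sides say \<open>(F f)' = - k h\<close> on \<open>(0, 1)\<close>. The differential equation alone leaves a constant of
  integration free; it is \<open>0\<close> because \<open>f\<close> is bounded and \<open>F\<close> tends to \<open>0\<close> at \<open>1\<close>.
\<close>

lemma average_iff_ode:
  assumes h: "continuous_on {0<..<1} h" "\<And>w. 0 < w \<Longrightarrow> w < 1 \<Longrightarrow> \<bar>h w\<bar> \<le> 1"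
    and f: "\<And>s. 0 < s \<Longrightarrow> s < 1 \<Longrightarrow> (f has_real_derivative f' s) (at s)"
      "\<And>w. 0 < w \<Longrightarrow> w < 1 \<Longrightarrow> \<bar>f w\<bar> \<le> 1"
  shows "(\<forall>s. 0 < s \<and> s < 1 \<longrightarrow> F s * f s = (LBINT w:{s<..<1}. k w * h w)) \<longleftrightarrow>
    (\<forall>s. 0 < s \<and> s < 1 \<longrightarrow> F s * f' s = k s * (f s - h s))" (is "?avg \<longleftrightarrow> ?ode")
proof -
  have Ff: "((\<lambda>s. F s * f s) has_real_derivative F s * f' s - k s * f s) (at s)" if "0 < s" "s < 1" for s
    by (rule derivative_eq_intros deriv f(1) that refl)+ (simp add: algebra_simps)
  have kh: "isCont (\<lambda>w. k w * h w) x" if "0 < x" "x < 1" for x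
    using h(1) isCont_k that by (intro isCont_mult) (auto simp: continuous_on_eq_continuous_at)
  show ?thesis
  proof
    assume avg: ?avg
    show ?ode
    proof safe
      fix s :: real assume s: "0 < s" "s < 1"
      \<comment> \<open>The integral up to \<open>1\<close> may be improper, so it is split at a point \<open>b\<close> beyond \<open>s\<close> that stays fixed
          while the lower limit is differentiated.\<close>
      define a b where "a = s / 2" and "b = (1 + s) / 2"
      have ab: "0 < a" "a < s" "s < b" "b < 1"
        using s by (auto simp: a_def b_def)
      have "((\<lambda>u. LBINT w=b..u. k w * h w) has_vector_derivative k s * h s) (at s within {a..b})"
        using ab kh by (intro interval_integral_FTC2)
          (auto intro!: continuous_at_imp_continuous_on)
      then have "((\<lambda>u. LBINT w=b..u. k w * h w) has_real_derivative k s * h s) (at s)"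
        using ab by (simp add: has_real_derivative_iff_has_vector_derivative at_within_Icc_at)
      then have "((\<lambda>u. (LBINT w:{b<..<1}. k w * h w) - (LBINT w=b..u. k w * h w))
          has_real_derivative - (k s * h s)) (at s)"
        by (auto intro!: derivative_eq_intros)
      moreover have "(LBINT w:{b<..<1}. k w * h w) - (LBINT w=b..u. k w * h w) = F u * f u"
        if u: "u \<in> {a<..<b}" for u
      proof -
        have "{u<..<1} = {u<..b} \<union> {b<..<1}"
          using u ab by auto
        moreover have "set_integrable lborel {u<..b} (\<lambda>w. k w * h w)"
          "set_integrable lborel {b<..<1} (\<lambda>w. k w * h w)"
          using u ab by (auto intro: set_integrable_subset[OF set_integrable_k_mult[OF _ _ h, of u]])
        ultimately have "(LBINT w:{u<..<1}. k w * h w)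
            = (LBINT w:{u<..b}. k w * h w) + (LBINT w:{b<..<1}. k w * h w)"
          by (subst \<open>{u<..<1} = _\<close>, intro set_integral_Un) auto
        moreover have "(LBINT w=b..u. k w * h w) = - (LBINT w:{u<..b}. k w * h w)"
          using u by (subst interval_integral_endpoints_reverse) (simp add: interval_integral_Ioc)
        ultimately show ?thesis
          using avg u ab by auto
      qed
      ultimately have "((\<lambda>u. F u * f u) has_real_derivative - (k s * h s)) (at s)"
        using ab by (elim has_field_derivative_transform_within_open[where S = "{a<..<b}"]) auto
      from DERIV_unique[OF this Ff[OF s]] show "F s * f' s = k s * (f s - h s)"
        by (simp add: algebra_simps)
    qed
  next
    assume ode: ?ode
    show ?avg
    proof safe
      fix s :: real assume s: "0 < s" "s < 1"
      have int: "set_integrable lborel {s<..<1} (\<lambda>w. k w * h w)"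
        using s h by (intro set_integrable_k_mult) auto
      have "(LBINT w=s..1. k w * h w) = 0 - (- (F s * f s))"
      proof (rule interval_integral_FTC_integrable)
        show "((\<lambda>s. - (F s * f s)) has_vector_derivative k x * h x) (at x)"
          if "ereal s < ereal x" "ereal x < 1" for x
        proof -
          have x: "0 < x" "x < 1"
            using that s by (auto simp: one_ereal_def)
          with ode have "k x * h x = - (F x * f' x - k x * f x)"
            by (simp add: algebra_simps)
          then show ?thesis
            using DERIV_minus[OF Ff[OF x]]
            by (simp add: has_real_derivative_iff_has_vector_derivative)
        qed
        show "(((\<lambda>s. - (F s * f s)) \<circ> real_of_ereal) \<longlongrightarrow> - (F s * f s)) (at_right (ereal s))"
          using Ff[OF s] unfolding ereal_tendsto_simps1
          by (intro tendsto_minus) (auto dest!: DERIV_isCont simp: isCont_def intro: tendsto_within_subset)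
        have "((\<lambda>s. F s * f s) \<longlongrightarrow> 0) (at_left 1)"
        proof (rule tendsto_0_le[where K = 1])
          show "(F \<longlongrightarrow> 0) (at_left 1)" by (rule lim)
          show "\<forall>\<^sub>F x in at_left 1. norm (F x * f x) \<le> norm (F x) * 1"
            using eventually_at_left_real[OF zero_less_one]
            by (rule eventually_mono) (use f(2) in \<open>auto simp: abs_mult intro!: mult_left_le\<close>)
        qed
        from tendsto_minus[OF this]
        show "(((\<lambda>s. - (F s * f s)) \<circ> real_of_ereal) \<longlongrightarrow> 0) (at_left 1)"
          by (simp add: ereal_tendsto_simps1 one_ereal_def)
      qed (use s kh int in \<open>auto simp: one_ereal_def\<close>)
      then show "F s * f s = (LBINT w:{s<..<1}. k w * h w)"
        using s by (simp add: interval_integral_Ioo one_ereal_def)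
    qed
  qed
qed

end

section \<open>Generating functions of thinned laws\<close>

lemma psi_in_unit_interval:
  assumes "0 \<le> r" "0 < m" "m \<le> r + 1" "0 \<le> s" "s \<le> 1"
  shows "psi m r s \<in> {0..1}"
proof -
  have "psi m r s = pgf (measure_pmf (psi_pmf_explicit m r)) s"
    using assms by (simp add: pgf_psi_pmf_explicit)
  then show ?thesis
    using pgf_bounds assms by simp
qed

text \<open>
  Conditionally on \<open>W = n\<close> the sum has generating function \<open>psi m r s ^ n\<close>, by independence. Working
  with nonnegative integrals makes integrability automatic.
\<close>

lemma pgf_thin:
  assumes mr: "0 \<le> r" "0 < m" "m \<le> r + 1" and s: "0 \<le> s" "s \<le> 1"
  shows "pgf (measure_pmf (thin m r W)) s = pgf (measure_pmf W) (psi m r s)"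
proof -
  define P where "P = psi_pmf m r"
  have pgf_P: "pgf (measure_pmf P) s = psi m r s"
    using assms by (simp add: P_def psi_pmf_eq_explicit pgf_psi_pmf_explicit)
  have psi: "0 \<le> psi m r s" "psi m r s \<le> 1"
    using psi_in_unit_interval[OF assms] by auto
  have rep: "(\<integral>\<^sup>+xs. ennreal (s ^ sum_list xs) \<partial>measure_pmf (replicate_pmf n P)) = ennreal (psi m r s ^ n)" for n
  proof (induction n)
    case (Suc n)
    have "(\<integral>\<^sup>+xs. ennreal (s ^ sum_list xs) \<partial>measure_pmf (replicate_pmf (Suc n) P))
      = (\<integral>\<^sup>+k. ennreal (s ^ k) * (\<integral>\<^sup>+xs. ennreal (s ^ sum_list xs) \<partial>measure_pmf (replicate_pmf n P)) \<partial>measure_pmf P)"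
      using s by (simp add: power_add ennreal_mult' nn_integral_cmult)
    also have "\<dots> = ennreal (psi m r s) * ennreal (psi m r s ^ n)"
      unfolding Suc using s by (simp add: nn_integral_multc ennreal_pgf[symmetric] pgf_P)
    finally show ?case
      using psi by (simp add: ennreal_mult')
  qed simp
  have "ennreal (pgf (measure_pmf (thin m r W)) s) = ennreal (pgf (measure_pmf W) (psi m r s))"
    using s psi rep by (simp add: ennreal_pgf thin_def P_def)
  then show ?thesis
    using pgf_bounds s psi by simp
qed

lemma borel_measurable_pgf: "pgf (measure_pmf p) \<in> borel_measurable borel"
proof -
  have "(\<lambda>(n, s). s ^ n) \<in> borel_measurable (count_space UNIV \<Otimes>\<^sub>M (borel :: real measure))"
    by (rule measurable_pair_measure_countable1) auto
  from measurable_pair_swap[OF this]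
  have "(\<lambda>(s :: real, n). s ^ n) \<in> borel_measurable (borel \<Otimes>\<^sub>M measure_pmf p)"
    using measurable_cong_sets[OF sets_pair_measure_cong[OF refl sets_measure_pmf_count_space[of p]] refl]
    by (auto simp: case_prod_beta)
  from measure_pmf.borel_measurable_lebesgue_integral[OF this] show ?thesis
    by (simp add: pgf_def[abs_def])
qed

lemma borel_measurable_indicator_mult:
  fixes f :: "real \<Rightarrow> real"
  assumes "A \<in> sets borel" "continuous_on A f"
  shows "(\<lambda>x. indicator A x * f x) \<in> borel_measurable borel"
  using borel_measurable_continuous_on_indicator[OF assms] by simp

lemma eq_integral_if_ennreal_eq:
  assumes "ennreal c = (\<integral>\<^sup>+x. ennreal (f x) \<partial>N)" "0 \<le> c" "f \<in> borel_measurable N" "\<And>x. 0 \<le> f x"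
  shows "c = (\<integral>x. f x \<partial>N)"
  using assms by (simp add: integral_eq_nn_integral flip: assms(1))

text \<open>
  This composition rule separates the two randomizations: mixing over \<open>m\<close> yields a generating function
  \<open>Q\<close>, and mixing over \<open>r\<close> then averages \<open>Q (psi 1 r s)\<close>.
\<close>

lemma psi_factorization: "psi m r s = psi m 0 (psi 1 r s)"
  by (simp add: psi_def)

lemma measure_pmf_if_prob_space:
  fixes N :: "nat measure"
  assumes "prob_space N" "sets N = UNIV"
  obtains p where "N = measure_pmf p"
proof -
  have "AE x in N. measure N {x} \<noteq> 0"
  proof -
    interpret prob_space N by fact
    have "AE x in N. \<forall>n. measure N {n} = 0 \<longrightarrow> x \<noteq> n"
      unfolding AE_all_countable
    proof
      fix n
      show "AE x in N. measure N {n} = 0 \<longrightarrow> x \<noteq> n"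
        using assms(2) by (cases "measure N {n} = 0")
          (auto intro!: AE_I[of _ _ "{n}"] simp: emeasure_eq_measure)
    qed
    then show ?thesis by eventually_elim auto
  qed
  then have "N = measure_pmf (Abs_pmf N)"
    using assms by (subst Abs_pmf_inverse) auto
  then show ?thesis by (rule that)
qed

lemma rand_thin_is_pmf:
  assumes "prob_space D" "sets D = sets (borel \<Otimes>\<^sub>M borel)"
  obtains p where "rand_thin D W = measure_pmf p"
proof (rule measure_pmf_if_prob_space)
  interpret prob_space D by fact
  have K: "(\<lambda>(m, r). measure_pmf (thin m r W)) \<in> measurable D (subprob_algebra (count_space UNIV))"
    using measurable_thin measurable_cong_sets[OF assms(2) refl] by blast
  show "prob_space (rand_thin D W)"
    unfolding rand_thin_def
    by (rule prob_space_bind[OF _ K]) (auto simp: measure_pmf.prob_space_axioms)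
  show "sets (rand_thin D W) = UNIV"
    unfolding rand_thin_def using sets_bind[OF sets_kernel[OF K] not_empty] by simp
qed

lemma ennreal_pgf_rand_thin:
  assumes "sets D = sets (borel \<Otimes>\<^sub>M borel)" "space D \<noteq> {}"
    and p: "rand_thin D W = measure_pmf p" and s: "0 \<le> s" "s \<le> 1"
  shows "ennreal (pgf (measure_pmf p) s) = (\<integral>\<^sup>+x. ennreal (pgf (measure_pmf (thin (fst x) (snd x) W)) s) \<partial>D)"
proof -
  have K: "(\<lambda>(m, r). measure_pmf (thin m r W)) \<in> measurable D (subprob_algebra (count_space UNIV))"
    using measurable_thin measurable_cong_sets[OF assms(1) refl] by blast
  have "(\<integral>\<^sup>+n. ennreal (s ^ n) \<partial>rand_thin D W)
      = (\<integral>\<^sup>+x. (\<integral>\<^sup>+n. ennreal (s ^ n) \<partial>(case x of (m, r) \<Rightarrow> measure_pmf (thin m r W))) \<partial>D)"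
    unfolding rand_thin_def by (rule nn_integral_bind[OF _ K]) simp
  then show ?thesis
    using s by (simp add: ennreal_pgf p case_prod_beta)
qed

lemma measurable_pgf_thin:
  assumes "0 \<le> s" "s \<le> 1"
  shows "(\<lambda>x. ennreal (pgf (measure_pmf (thin (fst x) (snd x) W)) s)) \<in> borel_measurable (borel \<Otimes>\<^sub>M borel)"
proof -
  have "(\<lambda>N. \<integral>\<^sup>+n. ennreal (s ^ n) \<partial>N) \<in> borel_measurable (subprob_algebra (count_space (UNIV :: nat set)))"
    by (rule nn_integral_measurable_subprob_algebra) simp
  from measurable_compose[OF measurable_thin this] show ?thesis
    using assms by (simp add: ennreal_pgf case_prod_beta)
qed

section \<open>Mixing over a power law and an exponential law\<close>

definition power_law :: "real \<Rightarrow> real measure" where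
  "power_law \<alpha> = density lborel (\<lambda>x. ennreal (power_density \<alpha> x))"

definition power_thinning_law :: "real \<Rightarrow> (real \<times> real) measure" where
  "power_thinning_law \<alpha> = distr (power_law \<alpha>) (borel \<Otimes>\<^sub>M borel) (\<lambda>m. (m, 0))"

lemma sets_power_law [measurable_cong]: "sets (power_law \<alpha>) = sets borel"
  by (simp add: power_law_def)

lemma sets_power_thinning_law: "sets (power_thinning_law \<alpha>) = sets (borel \<Otimes>\<^sub>M borel)"
  by (simp add: power_thinning_law_def)

lemma measurable_power_density [measurable]: "power_density \<alpha> \<in> borel_measurable borel"
  unfolding power_density_def by measurable

lemma prob_space_power_law:
  assumes \<alpha>: "0 < \<alpha>"
  shows "prob_space (power_law \<alpha>)"
proof -
  let ?f = "\<lambda>x. \<alpha> * x powr (\<alpha> - 1)"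
  have deriv: "((\<lambda>x. x powr \<alpha>) has_real_derivative ?f x) (at x)" if "0 < x" for x
    using that by (auto intro!: derivative_eq_intros)
  have "((\<lambda>x. x powr \<alpha>) \<longlongrightarrow> 0) (at_right 0)"
    using \<alpha> by (auto intro!: tendsto_eq_intros eventually_at_rightI[of 0 1])
  moreover have "((\<lambda>x. x powr \<alpha>) \<longlongrightarrow> 1) (at_left (1::real))"
    by (auto intro!: tendsto_eq_intros)
  ultimately have "set_integrable lborel (einterval 0 1) ?f" "(LBINT x=0..1. ?f x) = 1 - 0"
    using \<alpha> deriv
    by (intro interval_integral_FTC_nonneg[where F = "\<lambda>x. x powr \<alpha>"];
        auto simp: ereal_tendsto_simps1 zero_ereal_def one_ereal_def intro!: continuous_intros)+
  then have int: "integrable lborel (power_density \<alpha>)" "(LBINT x. power_density \<alpha> x) = 1"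
  proof -
    have *: "power_density \<alpha> = (\<lambda>x. indicator {0<..<1} x *\<^sub>R ?f x)"
      by (auto simp: power_density_def)
    show "set_integrable lborel (einterval 0 1) ?f \<Longrightarrow> integrable lborel (power_density \<alpha>)"
      "(LBINT x=0..1. ?f x) = 1 - 0 \<Longrightarrow> (LBINT x. power_density \<alpha> x) = 1"
      unfolding * by (simp_all add: set_integrable_def zero_ereal_def one_ereal_def
        interval_integral_Ioo set_lebesgue_integral_def mult.left_commute[of _ \<alpha>])
  qed
  have "(\<integral>\<^sup>+x. ennreal (power_density \<alpha> x) \<partial>lborel) = 1"
    using nn_integral_eq_integral[OF int(1)] int(2) \<alpha> by (simp add: power_density_def)
  then show ?thesis
    unfolding power_law_def by (intro prob_spaceI) (simp add: emeasure_density)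
qed

lemma power_thinning_is_pmf:
  assumes "0 < \<alpha>"
  obtains q where "rand_thin (power_thinning_law \<alpha>) W = measure_pmf q"
proof -
  have "prob_space (power_thinning_law \<alpha>)"
    unfolding power_thinning_law_def
    by (intro prob_space.prob_space_distr prob_space_power_law assms) measurable
  then show ?thesis
    using that by (rule rand_thin_is_pmf[OF _ sets_power_thinning_law])
qed

lemma ennreal_pgf_power_thinning:
  assumes p: "rand_thin (power_thinning_law \<alpha>) W = measure_pmf p" and s: "0 \<le> s" "s \<le> 1"
  shows "ennreal (pgf (measure_pmf p) s) = (\<integral>\<^sup>+m. ennreal (pgf (measure_pmf (thin m 0 W)) s) \<partial>power_law \<alpha>)"
proof -
  have "(\<lambda>m. (m, 0)) \<in> measurable (power_law \<alpha>) (borel \<Otimes>\<^sub>M borel)"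
    by measurable
  then have "(\<integral>\<^sup>+x. ennreal (pgf (measure_pmf (thin (fst x) (snd x) W)) s) \<partial>power_thinning_law \<alpha>)
    = (\<integral>\<^sup>+m. ennreal (pgf (measure_pmf (thin m 0 W)) s) \<partial>power_law \<alpha>)"
    unfolding power_thinning_law_def using measurable_pgf_thin[OF s, of W]
    by (subst nn_integral_distr) auto
  moreover have "space (power_thinning_law \<alpha>) \<noteq> {}"
    by (simp add: power_thinning_law_def space_pair_measure)
  ultimately show ?thesis
    using ennreal_pgf_rand_thin[OF sets_power_thinning_law _ p s] by simp
qed

lemma AE_power_law: "AE m in power_law \<alpha>. 0 < m \<and> m < 1"
  unfolding power_law_def by (subst AE_density) (auto simp: power_density_def)

lemma survival_function_power:
  assumes "0 < \<alpha>"
  shows "survival_function (\<lambda>s. (1 - s) powr \<alpha>) (\<lambda>s. \<alpha> * (1 - s) powr (\<alpha> - 1))"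
proof
  show "((\<lambda>s. (1 - s) powr \<alpha>) has_real_derivative - (\<alpha> * (1 - s) powr (\<alpha> - 1))) (at s)" if "s < 1" for s
    using that by (auto intro!: derivative_eq_intros)
  show "((\<lambda>s. (1 - s) powr \<alpha>) \<longlongrightarrow> 0) (at_left 1)"
    using assms by (auto intro!: tendsto_eq_intros eventually_at_leftI[of 0])
qed (use assms in \<open>auto intro!: continuous_intros\<close>)

text \<open>
  The survival function of \<open>1 - 1 / T\<close> for \<open>T\<close> exponential with mean \<open>\<theta>\<close>: the shift of \<open>1 / (1 - s)\<close> by an
  independent exponential variable is \<open>T\<close> conditioned to exceed \<open>1 / (1 - s)\<close>, by lack of memory.
\<close>

lemma survival_function_exponential:
  assumes "0 < \<theta>"
  shows "survival_function (\<lambda>s. exp (- 1 / (\<theta> * (1 - s)))) (\<lambda>s. exp (- 1 / (\<theta> * (1 - s))) / (\<theta> * (1 - s)\<^sup>2))"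
proof
  show "((\<lambda>s. exp (- 1 / (\<theta> * (1 - s)))) has_real_derivative
      - (exp (- 1 / (\<theta> * (1 - s))) / (\<theta> * (1 - s)\<^sup>2))) (at s)" if "s < 1" for s
    using that assms
    by (auto intro!: derivative_eq_intros simp: divide_simps power2_eq_square)
  have "filterlim (\<lambda>s::real. \<theta> * (1 - s)) (at_right 0) (at_left 1)"
    unfolding filterlim_at using assms
    by (auto intro!: tendsto_eq_intros eventually_at_leftI[of 0])
  then have "filterlim (\<lambda>s::real. inverse (\<theta> * (1 - s))) at_top (at_left 1)"
    by (rule filterlim_compose[OF filterlim_inverse_at_top_right])
  then have "filterlim (\<lambda>s::real. - 1 / (\<theta> * (1 - s))) at_bot (at_left 1)"
    unfolding filterlim_uminus_at_top by (simp add: field_simps)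
  then show "((\<lambda>s. exp (- 1 / (\<theta> * (1 - s)))) \<longlongrightarrow> 0) (at_left 1)"
    by (rule filterlim_compose[OF exp_at_bot])
qed (use assms in \<open>auto intro!: continuous_intros\<close>)

text \<open>
  The substitution \<open>w = 1 - m (1 - s)\<close> in the mixture \<open>\<alpha> \<integral> G(1 - m (1 - s)) m\<^bsup>\<alpha>-1\<^esup> dm\<close> of the
  generating function \<open>G\<close> of \<open>W\<close> over \<open>0 < m < 1\<close> gives an average of the survival-function type.
\<close>

lemma pgf_power_thinning:
  assumes \<alpha>: "0 < \<alpha>" and p: "rand_thin (power_thinning_law \<alpha>) W = measure_pmf p"
    and s: "0 \<le> s" "s < 1"
  shows "(1 - s) powr \<alpha> * pgf (measure_pmf p) s
    = (LBINT w:{s<..<1}. \<alpha> * (1 - w) powr (\<alpha> - 1) * pgf (measure_pmf W) w)"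
proof -
  define f where "f m = indicator {0<..<1} m * (\<alpha> * m powr (\<alpha> - 1) * pgf (measure_pmf W) (1 - m * (1 - s)))" for m :: real
  have arg: "0 < 1 - m * (1 - s)" "1 - m * (1 - s) < 1" if "0 < m" "m < 1" for m
  proof -
    have "m * (1 - s) < 1 * 1"
      using that s by (intro mult_less_le_imp_less) auto
    then show "0 < 1 - m * (1 - s)" by simp
    show "1 - m * (1 - s) < 1" using that s by simp
  qed
  have [measurable]: "f \<in> borel_measurable borel"
    unfolding f_def
  proof (rule borel_measurable_indicator_mult)
    have "continuous_on {0<..<1} (pgf (measure_pmf W))"
      by (auto intro!: continuous_at_imp_continuous_on pgf_isCont)
    then have "continuous_on {0<..<1} (\<lambda>m. pgf (measure_pmf W) (1 - m * (1 - s)))"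
      by (rule continuous_on_compose2) (use arg in \<open>auto intro!: continuous_intros\<close>)
    then show "continuous_on {0<..<1} (\<lambda>m. \<alpha> * m powr (\<alpha> - 1) * pgf (measure_pmf W) (1 - m * (1 - s)))"
      by (auto intro!: continuous_intros)
  qed simp
  have f_nonneg: "0 \<le> f m" for m
    using pgf_bounds(1)[of "1 - m * (1 - s)" W] arg[of m] \<alpha> by (auto simp: f_def indicator_def)
  have "ennreal (pgf (measure_pmf p) s) = (\<integral>\<^sup>+m. ennreal (pgf (measure_pmf (thin m 0 W)) s) \<partial>power_law \<alpha>)"
    using s by (intro ennreal_pgf_power_thinning[OF p]) auto
  also have "\<dots> = (\<integral>\<^sup>+m. ennreal (power_density \<alpha> m) * ennreal (pgf (measure_pmf (thin m 0 W)) s) \<partial>lborel)"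
  proof -
    have "(\<lambda>m. ennreal (pgf (measure_pmf (thin m 0 W)) s)) \<in> borel_measurable borel"
      using measurable_compose[OF _ measurable_pgf_thin, of "\<lambda>m. (m, 0)" borel s W] s by simp
    then show ?thesis
      unfolding power_law_def by (intro nn_integral_density) auto
  qed
  also have "\<dots> = (\<integral>\<^sup>+m. ennreal (f m) \<partial>lborel)"
    using s \<alpha> arg
    by (intro nn_integral_cong)
       (auto simp: f_def power_density_def pgf_thin psi_def ennreal_mult' indicator_def)
  finally have "pgf (measure_pmf p) s = (\<integral>m. f m \<partial>lborel)"
    using pgf_bounds(1)[of s p] s f_nonneg by (intro eq_integral_if_ennreal_eq) auto
  also have "\<dots> = 1 / (1 - s) * (\<integral>w. f (1 / (1 - s) + (- 1 / (1 - s)) * w) \<partial>lborel)"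
    using s by (subst lborel_integral_real_affine[of "- 1 / (1 - s)" f "1 / (1 - s)"]) auto
  finally have "(1 - s) powr \<alpha> * pgf (measure_pmf p) s
      = (\<integral>w. (1 - s) powr (\<alpha> - 1) * f (1 / (1 - s) + (- 1 / (1 - s)) * w) \<partial>lborel)"
    using s by (simp add: powr_diff)
  also have "\<dots> = (\<integral>w. indicator {s<..<1} w *\<^sub>R (\<alpha> * (1 - w) powr (\<alpha> - 1) * pgf (measure_pmf W) w) \<partial>lborel)"
  proof (rule Bochner_Integration.integral_cong)
    fix w
    have m: "1 / (1 - s) + (- 1 / (1 - s)) * w = (1 - w) / (1 - s)"
      by (simp add: diff_divide_distrib)
    have "(1 - w) / (1 - s) \<in> {0<..<1} \<longleftrightarrow> w \<in> {s<..<1}"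
      using s by (auto simp: field_simps)
    moreover have "(1 - s) powr (\<alpha> - 1) * ((1 - w) / (1 - s)) powr (\<alpha> - 1) = (1 - w) powr (\<alpha> - 1)" if "w < 1"
      using s that by (simp add: powr_divide)
    ultimately show "(1 - s) powr (\<alpha> - 1) * f (1 / (1 - s) + (- 1 / (1 - s)) * w)
        = indicator {s<..<1} w *\<^sub>R (\<alpha> * (1 - w) powr (\<alpha> - 1) * pgf (measure_pmf W) w)"
      unfolding m f_def using s by (auto simp: indicator_def)
  qed simp
  finally show ?thesis
    by (simp add: set_lebesgue_integral_def)
qed

definition exponential_law :: "real \<Rightarrow> real measure" where
  "exponential_law \<theta> = density lborel (\<lambda>x. ennreal (exponential_density (1 / \<theta>) x))"

lemma sets_exponential_law [measurable_cong]: "sets (exponential_law \<theta>) = sets borel"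
  by (simp add: exponential_law_def)

lemma prob_space_exponential_law: "0 < \<theta> \<Longrightarrow> prob_space (exponential_law \<theta>)"
  unfolding exponential_law_def by (intro prob_space_exponential_density) simp

lemma ennreal_pgf_product_thinning:
  assumes \<alpha>: "0 < \<alpha>" and \<theta>: "0 < \<theta>"
    and p: "rand_thin (power_law \<alpha> \<Otimes>\<^sub>M exponential_law \<theta>) W = measure_pmf p"
    and q: "rand_thin (power_thinning_law \<alpha>) W = measure_pmf q" and s: "0 \<le> s" "s \<le> 1"
  shows "ennreal (pgf (measure_pmf p) s) =
    (\<integral>\<^sup>+r. ennreal (pgf (measure_pmf q) (psi 1 r s)) \<partial>exponential_law \<theta>)"
proof -
  interpret PL: prob_space "power_law \<alpha>" using \<alpha> by (rule prob_space_power_law)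
  interpret EL: prob_space "exponential_law \<theta>" using \<theta> by (rule prob_space_exponential_law)
  interpret pair_prob_space "power_law \<alpha>" "exponential_law \<theta>" ..
  let ?T = "\<lambda>x. ennreal (pgf (measure_pmf (thin (fst x) (snd x) W)) s)"
  have sets: "sets (power_law \<alpha> \<Otimes>\<^sub>M exponential_law \<theta>) = sets (borel \<Otimes>\<^sub>M borel)"
    by (intro sets_pair_measure_cong sets_power_law sets_exponential_law)
  have T: "?T \<in> borel_measurable (power_law \<alpha> \<Otimes>\<^sub>M exponential_law \<theta>)"
    using measurable_pgf_thin[OF s] measurable_cong_sets[OF sets refl] by blast
  have "ennreal (pgf (measure_pmf p) s) = (\<integral>\<^sup>+x. ?T x \<partial>(power_law \<alpha> \<Otimes>\<^sub>M exponential_law \<theta>))"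
    by (rule ennreal_pgf_rand_thin[OF sets _ p s])
       (auto simp: space_pair_measure power_law_def exponential_law_def)
  also have "\<dots> = (\<integral>\<^sup>+r. \<integral>\<^sup>+m. ?T (m, r) \<partial>power_law \<alpha> \<partial>exponential_law \<theta>)"
    by (rule nn_integral_snd[symmetric]) (use T in \<open>simp add: case_prod_beta\<close>)
  also have "\<dots> = (\<integral>\<^sup>+r. ennreal (pgf (measure_pmf q) (psi 1 r s)) \<partial>exponential_law \<theta>)"
  proof (rule nn_integral_cong_AE)
    have "AE r in exponential_law \<theta>. 0 \<le> r"
      unfolding exponential_law_def
      by (subst AE_density) (auto simp: exponential_density_def)
    then show "AE r in exponential_law \<theta>. (\<integral>\<^sup>+m. ?T (m, r) \<partial>power_law \<alpha>) = ennreal (pgf (measure_pmf q) (psi 1 r s))"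
    proof eventually_elim
      case (elim r)
      have u: "0 \<le> psi 1 r s" "psi 1 r s \<le> 1"
        using psi_in_unit_interval[of r 1 s] elim s by auto
      have "AE m in power_law \<alpha>. ?T (m, r) = ennreal (pgf (measure_pmf (thin m 0 W)) (psi 1 r s))"
        using AE_power_law by eventually_elim (use elim s u in \<open>simp add: pgf_thin flip: psi_factorization\<close>)
      then show ?case
        unfolding ennreal_pgf_power_thinning[OF q u] by (rule nn_integral_cong_AE)
    qed
  qed
  finally show ?thesis .
qed

text \<open>
  Substituting \<open>w = psi 1 r s\<close>, which means \<open>r = 1 / (1 - w) - 1 / (1 - s)\<close>: the exponential density of
  \<open>r\<close> factors into a function of \<open>w\<close> and a function of \<open>s\<close>, and this makes the mixture an average of the
  survival-function type.
\<close>

lemma pgf_exponential_mixture: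
  assumes \<theta>: "0 < \<theta>" and s: "0 \<le> s" "s < 1"
    and p: "ennreal (pgf (measure_pmf p) s) =
      (\<integral>\<^sup>+r. ennreal (pgf (measure_pmf q) (psi 1 r s)) \<partial>exponential_law \<theta>)"
  shows "exp (- 1 / (\<theta> * (1 - s))) * pgf (measure_pmf p) s
    = (LBINT w:{s<..<1}. exp (- 1 / (\<theta> * (1 - w))) / (\<theta> * (1 - w)\<^sup>2) * pgf (measure_pmf q) w)"
proof -
  interpret survival_function "\<lambda>s. exp (- 1 / (\<theta> * (1 - s)))" "\<lambda>s. exp (- 1 / (\<theta> * (1 - s))) / (\<theta> * (1 - s)\<^sup>2)"
    using \<theta> by (rule survival_function_exponential)
  let ?Q = "pgf (measure_pmf q)"
  define f where "f r = 1 / \<theta> * exp (- r / \<theta>) * ?Q (psi 1 r s)" for r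
  define g where "g w = 1 / (1 - w) - 1 / (1 - s)" for w
  have u: "psi 1 r s = 1 - inverse (1 / (1 - s) + r)" "0 < psi 1 r s" "psi 1 r s < 1" if "0 < r" for r
  proof -
    show *: "psi 1 r s = 1 - inverse (1 / (1 - s) + r)"
      using s by (simp add: psi_def inverse_eq_divide divide_simps)
    have "1 < 1 / (1 - s) + r"
    proof -
      have "1 \<le> 1 / (1 - s)" using s by simp
      then show ?thesis using that by simp
    qed
    then show "0 < psi 1 r s" "psi 1 r s < 1"
      unfolding * by (auto simp: inverse_less_1_iff)
  qed
  have cont_f: "isCont f r" if "0 < r" for r
  proof -
    have pos: "0 < 1 + r * (1 - s)" using that s by (intro add_pos_nonneg) auto
    have "isCont (\<lambda>r. psi 1 r s) r"
      unfolding psi_def using pos by (intro continuous_intros) auto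
    then have "isCont (\<lambda>r. ?Q (psi 1 r s)) r"
      using u[OF that] by (intro isCont_o2[OF _ pgf_isCont]) auto
    then show ?thesis
      unfolding f_def using \<theta> by (intro continuous_intros) auto
  qed
  have f_nonneg: "0 \<le> f r" if "0 < r" for r
    using pgf_bounds(1)[of "psi 1 r s" q] u[OF that] \<theta> by (simp add: f_def)
  have g_pos: "0 < g w" if "s < w" "w < 1" for w
    using s that by (simp add: g_def frac_less2)
  have fg: "f (g w) * (1 / (1 - w)\<^sup>2) = exp (1 / (\<theta> * (1 - s))) *
      (exp (- 1 / (\<theta> * (1 - w))) / (\<theta> * (1 - w)\<^sup>2) * ?Q w)" if "s < w" "w < 1" for w
  proof -
    have "psi 1 (g w) s = w"
      using u(1)[OF g_pos[OF that]] by (simp add: g_def)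
    moreover have "exp (- g w / \<theta>) = exp (1 / (\<theta> * (1 - s))) * exp (- 1 / (\<theta> * (1 - w)))"
      unfolding exp_add[symmetric] g_def by (simp add: diff_divide_distrib mult.commute)
    ultimately show ?thesis
      by (simp add: f_def)
  qed
  have int: "set_integrable lborel {s<..<1} (\<lambda>w. exp (- 1 / (\<theta> * (1 - w))) / (\<theta> * (1 - w)\<^sup>2) * ?Q w)"
    using s pgf_bounds[of _ q] pgf_isCont
    by (intro set_integrable_k_mult) (auto intro!: continuous_at_imp_continuous_on)
  have "ennreal (pgf (measure_pmf p) s) = (\<integral>\<^sup>+r. ennreal (indicator {0<..} r * f r) \<partial>lborel)"
  proof -
    have "(\<lambda>r. ?Q (psi 1 r s)) \<in> borel_measurable borel"
      by (rule measurable_compose[OF _ borel_measurable_pgf]) (simp add: psi_def)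
    then have "ennreal (pgf (measure_pmf p) s)
        = (\<integral>\<^sup>+r. ennreal (exponential_density (1 / \<theta>) r) * ennreal (?Q (psi 1 r s)) \<partial>lborel)"
      unfolding p exponential_law_def by (intro nn_integral_density) auto
    also have "\<dots> = (\<integral>\<^sup>+r. ennreal (indicator {0<..} r * f r) \<partial>lborel)"
    proof (rule nn_integral_cong_AE)
      show "AE r in lborel. ennreal (exponential_density (1 / \<theta>) r) * ennreal (?Q (psi 1 r s))
          = ennreal (indicator {0<..} r * f r)"
        using AE_lborel_singleton[of "0::real"]
        by eventually_elim
          (use \<theta> in \<open>auto simp: exponential_density_def f_def indicator_def simp flip: ennreal_mult'\<close>)
    qed
    finally show ?thesis .
  qed
  moreover have "(\<lambda>r. indicator {0<..} r * f r) \<in> borel_measurable borel"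
    using cont_f by (intro borel_measurable_indicator_mult) (auto intro!: continuous_at_imp_continuous_on)
  ultimately have "pgf (measure_pmf p) s = (\<integral>r. indicator {0<..} r * f r \<partial>lborel)"
    using pgf_bounds(1)[of s p] s f_nonneg
    by (intro eq_integral_if_ennreal_eq) (auto simp: indicator_def)
  also have "\<dots> = (LBINT r=0..\<infinity>. f r)"
    by (simp add: interval_lebesgue_integral_0_infty set_lebesgue_integral_def)
  also have "\<dots> = (LBINT w=s..1. f (g w) * (1 / (1 - w)\<^sup>2))"
  proof (rule interval_integral_substitution_nonneg(2))
    show "(g has_real_derivative 1 / (1 - w)\<^sup>2) (at w)" if "ereal s < ereal w" "ereal w < 1" for w
      unfolding g_def using that
      by (auto intro!: derivative_eq_intros simp: one_ereal_def power2_eq_square)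
    show "((ereal \<circ> g \<circ> real_of_ereal) \<longlongrightarrow> 0) (at_right (ereal s))"
    proof -
      have "(g \<longlongrightarrow> 0) (at_right s)"
        unfolding g_def using s by (auto intro!: tendsto_eq_intros)
      then show ?thesis
        unfolding zero_ereal_def ereal_tendsto_simps1 unfolding comp_def lim_ereal .
    qed
    have "filterlim (\<lambda>w::real. 1 - w) (at_right 0) (at_left 1)"
      unfolding filterlim_at by (auto intro!: tendsto_eq_intros eventually_at_leftI[of 0])
    then have "filterlim (\<lambda>w::real. inverse (1 - w)) at_top (at_left 1)"
      by (rule filterlim_compose[OF filterlim_inverse_at_top_right])
    then have "filterlim g at_top (at_left 1)"
      unfolding g_def using filterlim_tendsto_add_at_top[OF tendsto_const, of _ "at_left 1" "- 1 / (1 - s)"]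
      by (simp add: inverse_eq_divide)
    then show "((ereal \<circ> g \<circ> real_of_ereal) \<longlongrightarrow> \<infinity>) (at_left 1)"
      unfolding one_ereal_def ereal_tendsto_simps1 unfolding comp_def tendsto_PInfty_eq_at_top .
    have "set_integrable lborel {s<..<1} (\<lambda>w. f (g w) * (1 / (1 - w)\<^sup>2))"
    proof (subst set_integrable_cong[OF refl refl])
      show "set_integrable lborel {s<..<1} (\<lambda>w. exp (1 / (\<theta> * (1 - s))) *
          (exp (- 1 / (\<theta> * (1 - w))) / (\<theta> * (1 - w)\<^sup>2) * ?Q w))"
        using int by (rule set_integrable_mult_right)
    qed (use fg in auto)
    then show "set_integrable lborel (einterval (ereal s) 1) (\<lambda>w. f (g w) * (1 / (1 - w)\<^sup>2))"
      by (simp add: one_ereal_def)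
  qed (use s cont_f f_nonneg g_pos in \<open>auto simp: one_ereal_def intro!: continuous_intros\<close>)
  also have "\<dots> = (LBINT w:{s<..<1}. f (g w) * (1 / (1 - w)\<^sup>2))"
    using s by (simp add: one_ereal_def interval_integral_Ioo)
  also have "\<dots> = (LBINT w:{s<..<1}. exp (1 / (\<theta> * (1 - s))) *
      (exp (- 1 / (\<theta> * (1 - w))) / (\<theta> * (1 - w)\<^sup>2) * ?Q w))"
    using fg by (intro set_lebesgue_integral_cong) auto
  also have "\<dots> = exp (1 / (\<theta> * (1 - s))) *
      (LBINT w:{s<..<1}. exp (- 1 / (\<theta> * (1 - w))) / (\<theta> * (1 - w)\<^sup>2) * ?Q w)"
    by (rule set_integral_mult_right)
  finally show ?thesis
    by (simp only: mult.assoc[symmetric]) (simp add: exp_add[symmetric])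
qed

section \<open>The differential equations in terms of coefficients\<close>

lemma pgf_deriv_one_minus_sums:
  assumes "0 < s" "s < 1"
  shows "(\<lambda>n. ((real n + 1) * pmf p (n + 1) - real n * pmf p n) * s ^ n) sums ((1 - s) * pgf_deriv p s)"
proof -
  have "diffs (pmf p) n - (if n = 0 then 0 else diffs (pmf p) (n - 1))
      = (real n + 1) * pmf p (n + 1) - real n * pmf p n" for n
    by (cases n) (auto simp: diffs_def)
  with sums_mult_one_minus[OF pgf_deriv_sums[OF assms, of p]] show ?thesis
    by simp
qed

text \<open>
  After cancelling \<open>(1 - s) powr (\<alpha> - 1)\<close> the equation reads \<open>(1 - s) Q' = \<alpha> (Q - G)\<close>, where \<open>Q\<close>
  and \<open>G\<close> are the generating functions of \<open>q\<close> and \<open>W\<close>: an identity between power series.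
\<close>

lemma power_ode_iff_coeffs:
  assumes \<alpha>: "0 < \<alpha>"
  shows "(\<forall>s. 0 < s \<and> s < 1 \<longrightarrow> (1 - s) powr \<alpha> * pgf_deriv q s
      = \<alpha> * (1 - s) powr (\<alpha> - 1) * (pgf (measure_pmf q) s - pgf (measure_pmf W) s))
    \<longleftrightarrow> (\<forall>n. \<alpha> * pmf W n = (real n + \<alpha>) * pmf q n - (real n + 1) * pmf q (n + 1))"
proof -
  have "(1 - s) powr \<alpha> * pgf_deriv q s
      = \<alpha> * (1 - s) powr (\<alpha> - 1) * (pgf (measure_pmf q) s - pgf (measure_pmf W) s)
    \<longleftrightarrow> (1 - s) * pgf_deriv q s = \<alpha> * (pgf (measure_pmf q) s - pgf (measure_pmf W) s)" if "s < 1" for s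
  proof -
    have "(1 - s) powr \<alpha> = (1 - s) powr (\<alpha> - 1) * (1 - s)"
      using that by (simp add: powr_diff)
    then show ?thesis
      using that by (simp add: mult.assoc mult.left_commute[of \<alpha>])
  qed
  then have "(\<forall>s. 0 < s \<and> s < 1 \<longrightarrow> (1 - s) powr \<alpha> * pgf_deriv q s
      = \<alpha> * (1 - s) powr (\<alpha> - 1) * (pgf (measure_pmf q) s - pgf (measure_pmf W) s))
    \<longleftrightarrow> (\<forall>s. 0 < s \<and> s < 1 \<longrightarrow> (1 - s) * pgf_deriv q s
      = \<alpha> * (pgf (measure_pmf q) s - pgf (measure_pmf W) s))"
    by blast
  also have "\<dots> \<longleftrightarrow> (\<forall>n. (real n + 1) * pmf q (n + 1) - real n * pmf q n = \<alpha> * (pmf q n - pmf W n))"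
  proof (rule power_series_eq_iff)
    fix s :: real assume s: "0 < s" "s < 1"
    then show "(\<lambda>n. ((real n + 1) * pmf q (n + 1) - real n * pmf q n) * s ^ n)
        sums ((1 - s) * pgf_deriv q s)"
      by (rule pgf_deriv_one_minus_sums)
    have "(\<lambda>n. \<alpha> * (pmf q n * s ^ n - pmf W n * s ^ n))
        sums (\<alpha> * (pgf (measure_pmf q) s - pgf (measure_pmf W) s))"
      using s by (intro sums_mult sums_diff pgf_pmf_sums) auto
    then show "(\<lambda>n. \<alpha> * (pmf q n - pmf W n) * s ^ n)
        sums (\<alpha> * (pgf (measure_pmf q) s - pgf (measure_pmf W) s))"
      by (simp add: algebra_simps)
  qed
  also have "\<dots> \<longleftrightarrow> (\<forall>n. \<alpha> * pmf W n = (real n + \<alpha>) * pmf q n - (real n + 1) * pmf q (n + 1))"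
    by (intro iff_allI) (auto simp: algebra_simps)
  finally show ?thesis .
qed

text \<open>
  After cancelling the exponential the equation reads \<open>Q = \<phi> - \<theta> (1 - s)\<^sup>2 \<phi>'\<close>, where \<open>\<phi>\<close> and \<open>Q\<close>
  are the generating functions of \<open>p\<close> and \<open>q\<close>, and the coefficients of the right-hand side are \<open>q_seq \<theta> (pmf p)\<close>.
\<close>

lemma exponential_ode_iff_coeffs:
  assumes \<theta>: "0 < \<theta>"
  shows "(\<forall>s. 0 < s \<and> s < 1 \<longrightarrow> exp (- 1 / (\<theta> * (1 - s))) * pgf_deriv p s
      = exp (- 1 / (\<theta> * (1 - s))) / (\<theta> * (1 - s)\<^sup>2) * (pgf (measure_pmf p) s - pgf (measure_pmf q) s))
    \<longleftrightarrow> (\<forall>n. pmf q n = q_seq \<theta> (pmf p) n)"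
proof -
  have "exp (- 1 / (\<theta> * (1 - s))) * pgf_deriv p s
      = exp (- 1 / (\<theta> * (1 - s))) / (\<theta> * (1 - s)\<^sup>2) * (pgf (measure_pmf p) s - pgf (measure_pmf q) s)
    \<longleftrightarrow> \<theta> * ((1 - s) * ((1 - s) * pgf_deriv p s)) = pgf (measure_pmf p) s - pgf (measure_pmf q) s"
    if "s < 1" for s
    using that \<theta> by (simp add: eq_divide_eq power2_eq_square ac_simps)
  then have "(\<forall>s. 0 < s \<and> s < 1 \<longrightarrow> exp (- 1 / (\<theta> * (1 - s))) * pgf_deriv p s
      = exp (- 1 / (\<theta> * (1 - s))) / (\<theta> * (1 - s)\<^sup>2) * (pgf (measure_pmf p) s - pgf (measure_pmf q) s))
    \<longleftrightarrow> (\<forall>s. 0 < s \<and> s < 1 \<longrightarrow> \<theta> * ((1 - s) * ((1 - s) * pgf_deriv p s))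
      = pgf (measure_pmf p) s - pgf (measure_pmf q) s)"
    by blast
  also have "\<dots> \<longleftrightarrow> (\<forall>n. pmf p n - q_seq \<theta> (pmf p) n = pmf p n - pmf q n)"
  proof (rule power_series_eq_iff)
    fix s :: real assume s: "0 < s" "s < 1"
    let ?e = "\<lambda>n. (real n + 1) * pmf p (n + 1) - real n * pmf p n"
    have *: "\<theta> * ((?e n - (if n = 0 then 0 else ?e (n - 1))) * s ^ n) = (pmf p n - q_seq \<theta> (pmf p) n) * s ^ n" for n
      by (cases n) (auto simp: q_seq_def algebra_simps)
    from sums_mult[OF sums_mult_one_minus[OF pgf_deriv_one_minus_sums[OF s, of p]], of \<theta>]
    show "(\<lambda>n. (pmf p n - q_seq \<theta> (pmf p) n) * s ^ n) sums (\<theta> * ((1 - s) * ((1 - s) * pgf_deriv p s)))"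
      by (simp only: *)
    show "(\<lambda>n. (pmf p n - pmf q n) * s ^ n) sums (pgf (measure_pmf p) s - pgf (measure_pmf q) s)"
      unfolding left_diff_distrib using s by (intro sums_diff pgf_pmf_sums) auto
  qed
  also have "\<dots> \<longleftrightarrow> (\<forall>n. pmf q n = q_seq \<theta> (pmf p) n)"
    by auto
  finally show ?thesis .
qed

section \<open>Total mass of the candidate coefficients\<close>

lemma sum_pmf_atMost_le_1: "(\<Sum>n\<le>N. pmf p n) \<le> 1" for p :: "nat pmf"
  by (simp flip: measure_measure_pmf_finite)

lemma pmf_sums_1: "pmf p sums 1" for p :: "nat pmf"
  using pgf_pmf_sums[of 1 p] by (simp add: pgf_def)

lemma pmf_of_sums_1:
  fixes a :: "nat \<Rightarrow> real"
  assumes "\<And>n. 0 \<le> a n" "a sums 1"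
  obtains p where "pmf p = a"
proof
  have "(\<integral>\<^sup>+n. ennreal (a n) \<partial>count_space UNIV) = 1"
    unfolding nn_integral_count_space_nat using suminf_ennreal_eq[OF assms] by simp
  then show "pmf (embed_pmf a) = a"
    by (intro ext pmf_embed_pmf assms(1))
qed

text \<open>
  With \<open>b n = n p\<^sub>n\<close>, the partial sums of \<open>p\<close> and of \<^const>\<open>q_seq\<close> up to \<open>N\<close> differ by
  \<open>\<theta> (b (N + 1) - b N)\<close>. The latter partial sums increase. If they exceeded \<open>1\<close>, then \<open>b\<close> would
  decrease at least linearly and become negative; if their limit were below \<open>1\<close>, then \<open>b\<close> would
  increase at least linearly, which would keep \<open>p\<^sub>n\<close> away from \<open>0\<close>.
\<close>

lemma q_seq_sums_1:
  assumes \<theta>: "0 < \<theta>" and nonneg: "\<And>n. 0 \<le> q_seq \<theta> (pmf p) n"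
  shows "q_seq \<theta> (pmf p) sums 1"
proof -
  define b where "b n = real n * pmf p n" for n
  define S where "S N = (\<Sum>n\<le>N. q_seq \<theta> (pmf p) n)" for N
  have b_nonneg: "0 \<le> b n" for n by (simp add: b_def)
  have diff: "(\<Sum>n\<le>N. pmf p n) - S N = \<theta> * (b (Suc N) - b N)" for N
    by (induction N) (auto simp: S_def b_def q_seq_def algebra_simps)
  have incseq: "incseq S"
    unfolding S_def by (intro incseq_SucI) (simp add: nonneg)
  have growth: "b N + j * c \<le> b (N + j)" if "\<And>n. n \<ge> N \<Longrightarrow> c \<le> b (Suc n) - b n" for N j and c :: real
  proof (induction j)
    case (Suc j)
    then show ?case using that[of "N + j"] by (simp add: algebra_simps)
  qed simp
  have decay: "b (N + j) \<le> b N - j * c" if "\<And>n. n \<ge> N \<Longrightarrow> b (Suc n) - b n \<le> - c" for N j and c :: real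
  proof (induction j)
    case (Suc j)
    then show ?case using that[of "N + j"] by (simp add: algebra_simps)
  qed simp
  have bound: "S N \<le> 1" for N
  proof (rule ccontr)
    assume "\<not> S N \<le> 1"
    define c where "c = (S N - 1) / \<theta>"
    have c: "0 < c" "\<theta> * c = S N - 1"
      using \<open>\<not> S N \<le> 1\<close> \<theta> by (auto simp: c_def)
    have "b (Suc n) - b n \<le> - c" if "n \<ge> N" for n
    proof -
      have "\<theta> * (b (Suc n) - b n) \<le> \<theta> * (- c)"
        using diff[of n] sum_pmf_atMost_le_1[of p n] incseqD[OF incseq that] c by linarith
      then show ?thesis by (simp only: mult_le_cancel_left_pos[OF \<theta>])
    qed
    from decay[OF this] have "real j * c \<le> b N" for j
      using b_nonneg[of "N + j"] by (smt (verit))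
    then show False
      using c reals_Archimedean3[of c] by (meson not_le)
  qed
  obtain L where L: "S \<longlonglongrightarrow> L" "\<And>N. S N \<le> L"
    using incseq_convergent[OF incseq, of 1] bound by blast
  have "L \<le> 1"
    using L(1) bound by (intro LIMSEQ_le_const2[of S]) auto
  moreover have "\<not> L < 1"
  proof
    assume "L < 1"
    define c where "c = (1 - L) / (2 * \<theta>)"
    have c: "0 < c" "\<theta> * c = (1 - L) / 2"
      using \<open>L < 1\<close> \<theta> by (auto simp: c_def)
    have "(\<lambda>N. (\<Sum>n\<le>N. pmf p n)) \<longlonglongrightarrow> 1"
      using pmf_sums_1 by (simp add: sums_def_le)
    then have "\<forall>\<^sub>F N in sequentially. (1 + L) / 2 < (\<Sum>n\<le>N. pmf p n)"
      using \<open>L < 1\<close> by (intro order_tendstoD(1)) auto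
    then obtain N where N: "(1 + L) / 2 < (\<Sum>i\<le>n. pmf p i)" if "n \<ge> N" for n
      unfolding eventually_sequentially by blast
    have "c \<le> b (Suc n) - b n" if "n \<ge> N" for n
    proof -
      have "\<theta> * c \<le> \<theta> * (b (Suc n) - b n)"
        using diff[of n] N[OF that] L(2)[of n] c by (simp add: field_simps)
      then show ?thesis using \<theta> by simp
    qed
    from growth[OF this] have lower: "real j * c \<le> real (N + j) * pmf p (N + j)" for j
      using b_nonneg[of N] by (smt (verit) b_def)
    have "pmf p \<longlonglongrightarrow> 0"
      using summable_pmf by (rule summable_LIMSEQ_zero)
    then have "\<forall>\<^sub>F n in sequentially. pmf p n < c / 2"
      using c by (intro order_tendstoD(2)) auto
    then obtain K where K: "pmf p n < c / 2" if "n \<ge> K" for n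
      unfolding eventually_sequentially by blast
    \<comment> \<open>This choice makes \<open>j\<close> at least half of \<open>N + j\<close>, and \<open>N + j\<close> at least \<open>K\<close>.\<close>
    define j where "j = N + K + 1"
    have "real (N + j) * pmf p (N + j) < real (N + j) * (c / 2)"
      using K[of "N + j"] by (intro mult_strict_left_mono) (auto simp: j_def)
    also have "\<dots> \<le> real j * c"
      using c by (simp add: j_def field_simps)
    finally show False using lower[of j] by simp
  qed
  ultimately have "S \<longlonglongrightarrow> 1" using L by simp
  then show ?thesis by (simp add: sums_def_le S_def[abs_def])
qed

text \<open>
  The partial sums up to \<open>N\<close> satisfy \<open>\<alpha> \<Sum> g = \<alpha> \<Sum> q - (N + 1) q\<^sub>N\<^sub>+\<^sub>1\<close>, hence they are at most \<open>1\<close>. If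
  their limit were below \<open>1\<close>, then \<open>q\<^sub>n\<close> would eventually dominate a multiple of the divergent harmonic
  series.
\<close>

lemma power_coeffs_sums_1:
  assumes \<alpha>: "0 < \<alpha>" and nonneg: "\<And>n. 0 \<le> g n"
    and g: "\<And>n. \<alpha> * g n = (real n + \<alpha>) * pmf q n - (real n + 1) * pmf q (n + 1)"
  shows "g sums 1"
proof -
  define b where "b n = real n * pmf q n" for n
  define S where "S N = (\<Sum>n\<le>N. g n)" for N
  have b_nonneg: "0 \<le> b n" for n by (simp add: b_def)
  have diff: "\<alpha> * S N = \<alpha> * (\<Sum>n\<le>N. pmf q n) - b (Suc N)" for N
  proof (induction N)
    case (Suc N)
    then show ?case using g[of "Suc N"] by (simp add: S_def b_def algebra_simps)
  qed (use g[of 0] in \<open>simp add: S_def b_def algebra_simps\<close>)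
  have incseq: "incseq S"
    unfolding S_def by (intro incseq_SucI) (simp add: nonneg)
  have bound: "S N \<le> 1" for N
  proof -
    have "\<alpha> * S N \<le> \<alpha> * 1"
      using diff[of N] b_nonneg[of "Suc N"] mult_left_mono[OF sum_pmf_atMost_le_1[of q N], of \<alpha>] \<alpha> by linarith
    then show ?thesis using \<alpha> by simp
  qed
  obtain L where L: "S \<longlonglongrightarrow> L" "\<And>N. S N \<le> L"
    using incseq_convergent[OF incseq, of 1] bound by blast
  have "L \<le> 1"
    using L(1) bound by (intro LIMSEQ_le_const2[of S]) auto
  moreover have "\<not> L < 1"
  proof
    assume "L < 1"
    define c where "c = \<alpha> * (1 - L) / 2"
    have c: "0 < c" using \<open>L < 1\<close> \<alpha> by (simp add: c_def)
    have "(\<lambda>N. (\<Sum>n\<le>N. pmf q n)) \<longlonglongrightarrow> 1"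
      using pmf_sums_1 by (simp add: sums_def_le)
    then have "\<forall>\<^sub>F N in sequentially. (1 + L) / 2 < (\<Sum>n\<le>N. pmf q n)"
      using \<open>L < 1\<close> by (intro order_tendstoD(1)) auto
    then have "\<forall>\<^sub>F N in sequentially. norm (c * (1 / real (Suc N))) \<le> pmf q (Suc N)"
    proof eventually_elim
      case (elim N)
      have "b (Suc N) = \<alpha> * ((\<Sum>n\<le>N. pmf q n) - S N)"
        using diff[of N] by (simp add: algebra_simps)
      also have "\<dots> \<ge> \<alpha> * ((1 - L) / 2)"
        using elim L(2)[of N] \<alpha> by (intro mult_left_mono) (auto simp: field_simps)
      finally have "c \<le> real (Suc N) * pmf q (Suc N)"
        by (simp add: c_def b_def)
      then show ?case using c by (simp add: field_simps)
    qed
    moreover have "summable (\<lambda>N. pmf q (Suc N))"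
      using summable_pmf by (subst summable_Suc_iff)
    ultimately have "summable (\<lambda>N. c * (1 / real (Suc N)))"
      by (rule summable_comparison_test_ev)
    then have "summable (\<lambda>N. 1 / real (Suc N))"
      using c by (subst (asm) summable_cmult_iff) auto
    then have "summable (\<lambda>n. inverse (real n))"
      by (subst summable_Suc_iff[symmetric]) (simp add: inverse_eq_divide)
    then show False using not_summable_harmonic[where 'a = real] by simp
  qed
  ultimately have "S \<longlonglongrightarrow> 1" using L by simp
  then show ?thesis by (simp add: sums_def_le S_def[abs_def])
qed

section \<open>Characterization of mixtures by coefficients\<close>

text \<open>
  Since laws are determined by their generating functions on \<open>(0, 1)\<close>, being the mixture means having
  the averaged generating function, which by \<open>average_iff_ode\<close> is a differential
  equation and hence a recursion for the coefficients.
\<close>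

lemma power_thinning_iff_coeffs:
  assumes \<alpha>: "0 < \<alpha>"
  shows "rand_thin (power_thinning_law \<alpha>) W = measure_pmf q \<longleftrightarrow>
    (\<forall>n. \<alpha> * pmf W n = (real n + \<alpha>) * pmf q n - (real n + 1) * pmf q (n + 1))"
proof -
  interpret survival_function "\<lambda>s. (1 - s) powr \<alpha>" "\<lambda>s. \<alpha> * (1 - s) powr (\<alpha> - 1)"
    using \<alpha> by (rule survival_function_power)
  obtain q' where q': "rand_thin (power_thinning_law \<alpha>) W = measure_pmf q'"
    using \<alpha> by (rule power_thinning_is_pmf)
  have "q' = q \<longleftrightarrow> (\<forall>s. 0 < s \<and> s < 1 \<longrightarrow> (1 - s) powr \<alpha> * pgf (measure_pmf q) s
    = (LBINT w:{s<..<1}. \<alpha> * (1 - w) powr (\<alpha> - 1) * pgf (measure_pmf W) w))" (is "_ \<longleftrightarrow> ?avg q")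
  proof
    have avg: "?avg q'"
      using pgf_power_thinning[OF \<alpha> q'] by simp
    show "?avg q" if "q' = q" using avg that by simp
    assume "?avg q"
    with avg have "(1 - s) powr \<alpha> * pgf (measure_pmf q') s = (1 - s) powr \<alpha> * pgf (measure_pmf q) s"
      if "0 < s" "s < 1" for s using that by simp
    then show "q' = q"
      by (intro pmf_eq_if_pgf_eq) simp
  qed
  also have "\<dots> \<longleftrightarrow> (\<forall>n. \<alpha> * pmf W n = (real n + \<alpha>) * pmf q n - (real n + 1) * pmf q (n + 1))"
    unfolding power_ode_iff_coeffs[OF \<alpha>, symmetric]
    by (intro average_iff_ode pgf_continuous_bounded pgf_has_derivative)
  finally show ?thesis
    by (simp add: q' measure_pmf_inject)
qed

text \<open>
  The same argument for the second randomization. The integral formula is needed on \<open>[0, 1)\<close>, while its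
  values on \<open>(0, 1)\<close> already determine the law; the two conclusions use one version each.
\<close>

lemma product_thinning_iff:
  assumes \<alpha>: "0 < \<alpha>" and \<theta>: "0 < \<theta>" and q: "rand_thin (power_thinning_law \<alpha>) W = measure_pmf q"
  shows product_thinning_iff_integral:
    "rand_thin (power_law \<alpha> \<Otimes>\<^sub>M exponential_law \<theta>) W = measure_pmf p \<longleftrightarrow>
      (\<forall>s. 0 \<le> s \<and> s < 1 \<longrightarrow> exp (- 1 / (\<theta> * (1 - s))) * pgf (measure_pmf p) s
        = (LBINT w:{s<..<1}. exp (- 1 / (\<theta> * (1 - w))) / (\<theta> * (1 - w)\<^sup>2) * pgf (measure_pmf q) w))"
      (is "?law \<longleftrightarrow> ?avg p")
    and product_thinning_iff_coeffs:
    "rand_thin (power_law \<alpha> \<Otimes>\<^sub>M exponential_law \<theta>) W = measure_pmf p \<longleftrightarrow>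
      (\<forall>n. pmf q n = q_seq \<theta> (pmf p) n)"
proof -
  interpret survival_function "\<lambda>s. exp (- 1 / (\<theta> * (1 - s)))" "\<lambda>s. exp (- 1 / (\<theta> * (1 - s))) / (\<theta> * (1 - s)\<^sup>2)"
    using \<theta> by (rule survival_function_exponential)
  let ?avg' = "\<lambda>p. \<forall>s. 0 < s \<and> s < 1 \<longrightarrow> exp (- 1 / (\<theta> * (1 - s))) * pgf (measure_pmf p) s
    = (LBINT w:{s<..<1}. exp (- 1 / (\<theta> * (1 - w))) / (\<theta> * (1 - w)\<^sup>2) * pgf (measure_pmf q) w)"
  interpret PL: prob_space "power_law \<alpha>" using \<alpha> by (rule prob_space_power_law)
  interpret EL: prob_space "exponential_law \<theta>" using \<theta> by (rule prob_space_exponential_law)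
  interpret pair_prob_space "power_law \<alpha>" "exponential_law \<theta>" ..
  obtain p' where p': "rand_thin (power_law \<alpha> \<Otimes>\<^sub>M exponential_law \<theta>) W = measure_pmf p'"
    by (rule rand_thin_is_pmf[OF prob_space_axioms
      sets_pair_measure_cong[OF sets_power_law sets_exponential_law]])
  have avg: "?avg p'"
    using pgf_exponential_mixture[OF \<theta> _ _ ennreal_pgf_product_thinning[OF \<alpha> \<theta> p' q]] by simp
  have law: "?law \<longleftrightarrow> p' = p"
    by (simp add: p' measure_pmf_inject)
  have "p' = p" if "?avg' p"
  proof (rule pmf_eq_if_pgf_eq)
    fix s :: real assume s: "0 < s" "s < 1"
    with avg that have "exp (- 1 / (\<theta> * (1 - s))) * pgf (measure_pmf p') s
        = exp (- 1 / (\<theta> * (1 - s))) * pgf (measure_pmf p) s" by simp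
    then show "pgf (measure_pmf p') s = pgf (measure_pmf p) s" by simp
  qed
  moreover have "?avg' p" if "?avg p" using that by simp
  ultimately have eqs: "?law \<longleftrightarrow> ?avg p" "?law \<longleftrightarrow> ?avg' p"
    using avg law by blast+
  show "?law \<longleftrightarrow> ?avg p" by (rule eqs)
  have "?avg' p \<longleftrightarrow> (\<forall>n. pmf q n = q_seq \<theta> (pmf p) n)"
    unfolding exponential_ode_iff_coeffs[OF \<theta>, symmetric]
    by (intro average_iff_ode pgf_continuous_bounded pgf_has_derivative)
  with eqs show "?law \<longleftrightarrow> (\<forall>n. pmf q n = q_seq \<theta> (pmf p) n)" by blast
qed

lemma alpha_monotone_iff:
  "alpha_monotone \<alpha> \<mu> \<longleftrightarrow> (\<exists>W. \<mu> = rand_thin (power_thinning_law \<alpha>) W)"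
  by (simp add: alpha_monotone_def MR_monotone_def power_thinning_law_def power_law_def)

theorem proposition4p3:
  fixes \<alpha> \<theta> :: real
    and \<Omega> :: "'a measure" and M R :: "'a \<Rightarrow> real"
    and \<Omega>' :: "'b measure" and X :: "'b \<Rightarrow> nat" and p :: "nat \<Rightarrow> real"
  assumes "\<alpha> > 0" and "\<theta> > 0"
    and "prob_space \<Omega>"
    and "prob_space.indep_var \<Omega> borel M borel R"
    and "distributed \<Omega> lborel M (\<lambda>x. ennreal (power_density \<alpha> x))"
    and "distributed \<Omega> lborel R (\<lambda>x. ennreal (exponential_density (1 / \<theta>) x))"
    and "prob_space \<Omega>'"
    and "X \<in> measurable \<Omega>' (count_space UNIV)"
    and "\<And>n. p n = measure \<Omega>' {\<omega> \<in> space \<Omega>'. X \<omega> = n}"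
  defines "D \<equiv> distr \<Omega> (borel \<Otimes>\<^sub>M borel) (\<lambda>\<omega>. (M \<omega>, R \<omega>))"
    and "\<mu> \<equiv> distr \<Omega>' (count_space UNIV) X"
  shows "(MR_monotone D \<mu> \<longleftrightarrow>
      (\<exists>\<nu> :: nat pmf. alpha_monotone \<alpha> (measure_pmf \<nu>) \<and>
        (\<forall>s. 0 \<le> s \<and> s < 1 \<longrightarrow>
          pgf \<mu> s = 1 / \<theta> * exp (1 / (\<theta> * (1 - s))) *
            (LBINT w:{s<..<1}. 1 / (1 - w)\<^sup>2 * exp (- 1 / (\<theta> * (1 - w))) * pgf (measure_pmf \<nu>) w))))
    \<and> (MR_monotone D \<mu> \<longleftrightarrow>
      (\<forall>n. q_seq \<theta> p n \<ge> 0 \<and> (real n + \<alpha>) * q_seq \<theta> p n \<ge> (real n + 1) * q_seq \<theta> p (n + 1)))"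
proof -
  note \<alpha> = \<open>\<alpha> > 0\<close> and \<theta> = \<open>\<theta> > 0\<close>
  interpret prob_space \<Omega> by fact
  have "distr \<Omega> borel M = power_law \<alpha>" "distr \<Omega> borel R = exponential_law \<theta>"
    using assms(5,6) unfolding distributed_def power_law_def exponential_law_def
    by (auto cong: distr_cong)
  then have D: "D = power_law \<alpha> \<Otimes>\<^sub>M exponential_law \<theta>"
    using assms(4) unfolding D_def indep_var_distribution_eq by simp
  have "prob_space \<mu>"
    unfolding \<mu>_def using assms(7,8) by (rule prob_space.prob_space_distr)
  then obtain P where P: "\<mu> = measure_pmf P"
    by (rule measure_pmf_if_prob_space) (simp add: \<mu>_def)
  have p: "p = pmf P"
  proof
    fix n
    have "pmf P n = measure \<mu> {n}"
      by (simp add: P measure_pmf_single)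
    also have "\<dots> = p n"
      using assms(8,9) by (simp add: \<mu>_def measure_distr vimage_def Int_def conj_commute)
    finally show "p n = pmf P n" by simp
  qed
  have integral: "1 / \<theta> * exp (1 / (\<theta> * (1 - s))) *
        (LBINT w:{s<..<1}. 1 / (1 - w)\<^sup>2 * exp (- 1 / (\<theta> * (1 - w))) * h w)
      = exp (1 / (\<theta> * (1 - s))) * (LBINT w:{s<..<1}. exp (- 1 / (\<theta> * (1 - w))) / (\<theta> * (1 - w)\<^sup>2) * h w)" for s h
  proof -
    have "(LBINT w:{s<..<1}. exp (- 1 / (\<theta> * (1 - w))) / (\<theta> * (1 - w)\<^sup>2) * h w)
        = (LBINT w:{s<..<1}. 1 / \<theta> * (1 / (1 - w)\<^sup>2 * exp (- 1 / (\<theta> * (1 - w))) * h w))"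
      by (intro set_lebesgue_integral_cong) auto
    also have "\<dots> = 1 / \<theta> * (LBINT w:{s<..<1}. 1 / (1 - w)\<^sup>2 * exp (- 1 / (\<theta> * (1 - w))) * h w)"
      by (rule set_integral_mult_right)
    finally show ?thesis by (simp only: ac_simps)
  qed
  have formula: "pgf \<mu> s = 1 / \<theta> * exp (1 / (\<theta> * (1 - s))) *
        (LBINT w:{s<..<1}. 1 / (1 - w)\<^sup>2 * exp (- 1 / (\<theta> * (1 - w))) * pgf (measure_pmf \<nu>) w)
      \<longleftrightarrow> exp (- 1 / (\<theta> * (1 - s))) * pgf (measure_pmf P) s
        = (LBINT w:{s<..<1}. exp (- 1 / (\<theta> * (1 - w))) / (\<theta> * (1 - w)\<^sup>2) * pgf (measure_pmf \<nu>) w)" for s \<nu>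
    unfolding integral P by (auto simp: exp_minus field_simps)
  have law: "MR_monotone D \<mu> \<longleftrightarrow> (\<exists>W. rand_thin (power_law \<alpha> \<Otimes>\<^sub>M exponential_law \<theta>) W = measure_pmf P)"
    unfolding MR_monotone_def D P by (intro iff_exI) auto
  have "MR_monotone D \<mu> \<longleftrightarrow> (\<exists>\<nu>. alpha_monotone \<alpha> (measure_pmf \<nu>) \<and>
      (\<forall>s. 0 \<le> s \<and> s < 1 \<longrightarrow> exp (- 1 / (\<theta> * (1 - s))) * pgf (measure_pmf P) s
        = (LBINT w:{s<..<1}. exp (- 1 / (\<theta> * (1 - w))) / (\<theta> * (1 - w)\<^sup>2) * pgf (measure_pmf \<nu>) w)))"
    (is "_ \<longleftrightarrow> (\<exists>\<nu>. _ \<and> ?avg \<nu>)")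
  proof
    assume "MR_monotone D \<mu>"
    then obtain W where W: "rand_thin (power_law \<alpha> \<Otimes>\<^sub>M exponential_law \<theta>) W = measure_pmf P"
      unfolding law ..
    obtain \<nu> where \<nu>: "rand_thin (power_thinning_law \<alpha>) W = measure_pmf \<nu>"
      using \<alpha> by (rule power_thinning_is_pmf)
    have "?avg \<nu>"
      using W by (rule product_thinning_iff_integral[OF \<alpha> \<theta> \<nu>, THEN iffD1])
    moreover have "alpha_monotone \<alpha> (measure_pmf \<nu>)"
      unfolding alpha_monotone_iff using \<nu>[symmetric] ..
    ultimately show "\<exists>\<nu>. alpha_monotone \<alpha> (measure_pmf \<nu>) \<and> ?avg \<nu>"
      by blast
  next
    assume "\<exists>\<nu>. alpha_monotone \<alpha> (measure_pmf \<nu>) \<and> ?avg \<nu>"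
    then obtain \<nu> where mono: "alpha_monotone \<alpha> (measure_pmf \<nu>)" and avg: "?avg \<nu>"
      by blast
    from mono obtain W where "measure_pmf \<nu> = rand_thin (power_thinning_law \<alpha>) W"
      unfolding alpha_monotone_iff ..
    note \<nu> = this[symmetric]
    from avg have "rand_thin (power_law \<alpha> \<Otimes>\<^sub>M exponential_law \<theta>) W = measure_pmf P"
      by (rule product_thinning_iff_integral[OF \<alpha> \<theta> \<nu>, THEN iffD2])
    then show "MR_monotone D \<mu>"
      unfolding law ..
  qed
  moreover have "MR_monotone D \<mu> \<longleftrightarrow>
      (\<forall>n. q_seq \<theta> p n \<ge> 0 \<and> (real n + \<alpha>) * q_seq \<theta> p n \<ge> (real n + 1) * q_seq \<theta> p (n + 1))"
  proof
    assume "MR_monotone D \<mu>"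
    then obtain W where W: "rand_thin (power_law \<alpha> \<Otimes>\<^sub>M exponential_law \<theta>) W = measure_pmf P"
      unfolding law ..
    obtain q where q: "rand_thin (power_thinning_law \<alpha>) W = measure_pmf q"
      using \<alpha> by (rule power_thinning_is_pmf)
    have "q_seq \<theta> p n = pmf q n" for n
      using W unfolding product_thinning_iff_coeffs[OF \<alpha> \<theta> q] p by simp
    moreover have "0 \<le> (real n + \<alpha>) * pmf q n - (real n + 1) * pmf q (n + 1)" for n
    proof -
      have "\<alpha> * pmf W n = (real n + \<alpha>) * pmf q n - (real n + 1) * pmf q (n + 1)"
        using q unfolding power_thinning_iff_coeffs[OF \<alpha>] by blast
      moreover have "0 \<le> \<alpha> * pmf W n" using \<alpha> by simp
      ultimately show ?thesis by simp
    qed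
    ultimately show "\<forall>n. q_seq \<theta> p n \<ge> 0 \<and> (real n + \<alpha>) * q_seq \<theta> p n \<ge> (real n + 1) * q_seq \<theta> p (n + 1)"
      by simp
  next
    assume iii: "\<forall>n. q_seq \<theta> p n \<ge> 0 \<and> (real n + \<alpha>) * q_seq \<theta> p n \<ge> (real n + 1) * q_seq \<theta> p (n + 1)"
    then have "q_seq \<theta> p sums 1"
      unfolding p by (intro q_seq_sums_1 \<theta>) simp
    then obtain q where q: "pmf q = q_seq \<theta> p"
      using iii by (elim pmf_of_sums_1[rotated]) auto
    define g where "g n = ((real n + \<alpha>) * pmf q n - (real n + 1) * pmf q (n + 1)) / \<alpha>" for n
    have g: "\<alpha> * g n = (real n + \<alpha>) * pmf q n - (real n + 1) * pmf q (n + 1)" "0 \<le> g n" for n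
      using iii \<alpha> unfolding g_def q by auto
    have "g sums 1"
      using \<alpha> g(2) g(1) by (rule power_coeffs_sums_1)
    with g(2) obtain W where W: "pmf W = g"
      by (rule pmf_of_sums_1)
    have "rand_thin (power_thinning_law \<alpha>) W = measure_pmf q"
      unfolding power_thinning_iff_coeffs[OF \<alpha>] W using g by simp
    from product_thinning_iff_coeffs[OF \<alpha> \<theta> this]
    have "rand_thin (power_law \<alpha> \<Otimes>\<^sub>M exponential_law \<theta>) W = measure_pmf P"
      by (simp add: q p)
    then show "MR_monotone D \<mu>"
      unfolding law ..
  qed
  ultimately show ?thesis
    unfolding formula by (rule conjI)
qed

end
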